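(* Assume that $g$ is bounded and that the following condition holds: for every $\alpha\in(0,1)$ and every positive integer $S$, optimal processes in the problems $$\min_{y_0\in Y,\,u(\cdot)\in\mathcal{U}(y_0)}\sum_{t=0}^\infty\alpha^t g(y(t),u(t))\quad\text{and}\quad \min_{y_0\in Y,\,u(\cdot)\in\mathcal{U}_S(y_0)}\sum_{t=0}^{S-1}g(y(t),u(t))$$ (minimization being over both the control and the initial condition) exist, and there is a bounded set $D\subset G$, independent of $\alpha$ and $S$, in which all these optimal processes remain. Then the limits $\lim_{\alpha\to1^-}\min_{y\in Y}V_\alpha(y)$ and $\lim_{S\to\infty}\min_{y\in Y}V(S,y)$ exist and $$g^*=\lim_{\alpha\to1^-}\min_{y\in Y}V_\alpha(y)=\lim_{S\to\infty}\min_{y\in Y}V(S,y).$$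
   Context: System. $Y\subset\mathbb{R}^m$ is a nonempty closed unbounded set, $U_0$ is a compact metric space, $U(\cdot):Y\leadsto U_0$ is an upper semicontinuous compact-valued set-valued map, $f:\mathbb{R}^m\times U_0\to\mathbb{R}^m$ is continuous, and $|f(y,u)|\to\infty$ as $|y|\to\infty$ uniformly in $u$. Consider the discrete-time system $y(t+1)=f(y(t),u(t))$, $t=0,1,\dots$, $y(0)=y_0$, $y(t)\in Y$, $u(t)\in U(y(t))$. Let $G=\{(y,u): y\in Y,\ u\in U(y),\ f(y,u)\in Y\}$. A control $u(\cdot)$ and the pair $(y(\cdot),u(\cdot))$ are called admissible if these relations hold; an admissible process satisfies $(y(t),u(t))\in G$ for all $t$ under consideration. $\mathcal{U}(y_0)$ is the set of admissible controls on the infinite horizon, and $\mathcal{U}_S(y_0)$ the set of admissible controls on $\{0,\dots,S-1\}$ ($S$ a positive integer), for the initial condition $y_0$. It is assumed that $\mathcal{U}(y_0)\ne\emptyset$ for all $y_0\in Y$. Cost. $g:\mathbb{R}^m\times U_0\to\mathbb{R}$ is continuous and bounded below. For $\alpha\in(0,1)$, $$V_\alpha(y_0)=(1-\alpha)\inf_{u(\cdot)\in\mathcal{U}(y_0)}\sum_{t=0}^\infty\alpha^t g(y(t),u(t)),\qquad V(S,y_0)=\frac1S\min_{u(\cdot)\in\mathcal{U}_S(y_0)}\sum_{t=0}^{S-1}g(y(t),u(t)).$$ $\bar Y=Y\cup\{\infty_Y\}$ is the one-point compactification of $Y$; $\varphi\in C(\bar Y)$ means that $\varphi$ is continuous and real-valued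 on $Y$ with a finite limit as $|y|\to\infty$. $\mathcal{P}(G)$ is the set of Borel probability measures on $G$, $$W=\Big\{\gamma\in\mathcal{P}(G): \int_G(\varphi(f(y,u))-\varphi(y))\,d\gamma=0\ \ \forall\varphi\in C(\bar Y)\Big\},\qquad g^*=\inf_{\gamma\in W}\int_G g(y,u)\,d\gamma .$$ *)

theory Defs
  imports "HOL-Probability.Probability"
begin

text \<open>
  The data are: a set \<open>Y\<close> in Euclidean space, the control space as a subset \<open>U0\<close> of a metric
  space, the set-valued map as a function \<open>U\<close> into sets (used on \<open>Y\<close> only), and functions
  \<open>f\<close>, \<open>g\<close> on pairs (used on \<open>UNIV \<times> U0\<close> only).
\<close>

text \<open>Neighbourhoods of \<open>U y\<close> may be taken in the ambient metric space: for a map with values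
  in \<open>U0\<close> this agrees with using relatively open subsets of \<open>U0\<close>.\<close>

definition usc_on :: "'a::topological_space set \<Rightarrow> ('a \<Rightarrow> 'b::topological_space set) \<Rightarrow> bool" where
  "usc_on Y U \<longleftrightarrow>
     (\<forall>y\<in>Y. \<forall>N. open N \<and> U y \<subseteq> N \<longrightarrow> (\<forall>\<^sub>F z in at y within Y. U z \<subseteq> N))"

definition pairs_G ::
  "'a set \<Rightarrow> ('a \<Rightarrow> 'u set) \<Rightarrow> ('a \<times> 'u \<Rightarrow> 'a) \<Rightarrow> ('a \<times> 'u) set" where
  "pairs_G Y U f = {(y, u). y \<in> Y \<and> u \<in> U y \<and> f (y, u) \<in> Y}"

primrec traj :: "('a \<times> 'u \<Rightarrow> 'a) \<Rightarrow> 'a \<Rightarrow> (nat \<Rightarrow> 'u) \<Rightarrow> nat \<Rightarrow> 'a" where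
  "traj f y0 u 0 = y0"
| "traj f y0 u (Suc t) = f (traj f y0 u t, u t)"

definition adm_controls ::
  "'a set \<Rightarrow> ('a \<Rightarrow> 'u set) \<Rightarrow> ('a \<times> 'u \<Rightarrow> 'a) \<Rightarrow> 'a \<Rightarrow> (nat \<Rightarrow> 'u) set" where
  "adm_controls Y U f y0 = {u. \<forall>t. (traj f y0 u t, u t) \<in> pairs_G Y U f}"

text \<open>Controls on \<open>{0, \<dots>, S - 1}\<close> are functions that are \<open>undefined\<close> outside that set.
  Membership in \<open>pairs_G\<close> at time \<open>S - 1\<close> includes the requirement that the terminal state
  at time \<open>S\<close> lies in \<open>Y\<close>.\<close>

definition adm_controls_fin ::
  "'a set \<Rightarrow> ('a \<Rightarrow> 'u set) \<Rightarrow> ('a \<times> 'u \<Rightarrow> 'a) \<Rightarrow> nat \<Rightarrow> 'a \<Rightarrow> (nat \<Rightarrow> 'u) set" where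
  "adm_controls_fin Y U f S y0 =
     {u \<in> extensional {..<S}. \<forall>t<S. (traj f y0 u t, u t) \<in> pairs_G Y U f}"

definition disc_cost ::
  "('a \<times> 'u \<Rightarrow> 'a) \<Rightarrow> ('a \<times> 'u \<Rightarrow> real) \<Rightarrow> real \<Rightarrow> 'a \<Rightarrow> (nat \<Rightarrow> 'u) \<Rightarrow> real" where
  "disc_cost f g \<alpha> y0 u = (\<Sum>t. \<alpha> ^ t * g (traj f y0 u t, u t))"

definition fin_cost ::
  "('a \<times> 'u \<Rightarrow> 'a) \<Rightarrow> ('a \<times> 'u \<Rightarrow> real) \<Rightarrow> nat \<Rightarrow> 'a \<Rightarrow> (nat \<Rightarrow> 'u) \<Rightarrow> real" where
  "fin_cost f g S y0 u = (\<Sum>t<S. g (traj f y0 u t, u t))"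

text \<open>The value functions and the optimal value of the linear program are real-valued infima;
  they are meaningful for bounded \<open>g\<close>, when the series converges and the costs are bounded
  below. The minimum over controls in \<open>val_fin\<close> is an infimum here; under the compactness
  and continuity assumptions on the system it is attained.\<close>

definition val_disc ::
  "'a set \<Rightarrow> ('a \<Rightarrow> 'u set) \<Rightarrow> ('a \<times> 'u \<Rightarrow> 'a) \<Rightarrow> ('a \<times> 'u \<Rightarrow> real) \<Rightarrow> real \<Rightarrow> 'a \<Rightarrow> real" where
  "val_disc Y U f g \<alpha> y0 = (1 - \<alpha>) * (INF u\<in>adm_controls Y U f y0. disc_cost f g \<alpha> y0 u)"

definition val_fin ::
  "'a set \<Rightarrow> ('a \<Rightarrow> 'u set) \<Rightarrow> ('a \<times> 'u \<Rightarrow> 'a) \<Rightarrow> ('a \<times> 'u \<Rightarrow> real) \<Rightarrow> nat \<Rightarrow> 'a \<Rightarrow> real" where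
  "val_fin Y U f g S y0 = 1 / real S * (INF u\<in>adm_controls_fin Y U f S y0. fin_cost f g S y0 u)"

text \<open>Optimality is over both the control and the initial condition.\<close>

definition disc_optimal ::
  "'a set \<Rightarrow> ('a \<Rightarrow> 'u set) \<Rightarrow> ('a \<times> 'u \<Rightarrow> 'a) \<Rightarrow> ('a \<times> 'u \<Rightarrow> real) \<Rightarrow>
   real \<Rightarrow> 'a \<Rightarrow> (nat \<Rightarrow> 'u) \<Rightarrow> bool" where
  "disc_optimal Y U f g \<alpha> y0 u \<longleftrightarrow>
     y0 \<in> Y \<and> u \<in> adm_controls Y U f y0 \<and>
     (\<forall>z0\<in>Y. \<forall>v\<in>adm_controls Y U f z0. disc_cost f g \<alpha> y0 u \<le> disc_cost f g \<alpha> z0 v)"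

definition fin_optimal ::
  "'a set \<Rightarrow> ('a \<Rightarrow> 'u set) \<Rightarrow> ('a \<times> 'u \<Rightarrow> 'a) \<Rightarrow> ('a \<times> 'u \<Rightarrow> real) \<Rightarrow>
   nat \<Rightarrow> 'a \<Rightarrow> (nat \<Rightarrow> 'u) \<Rightarrow> bool" where
  "fin_optimal Y U f g S y0 u \<longleftrightarrow>
     y0 \<in> Y \<and> u \<in> adm_controls_fin Y U f S y0 \<and>
     (\<forall>z0\<in>Y. \<forall>v\<in>adm_controls_fin Y U f S z0. fin_cost f g S y0 u \<le> fin_cost f g S z0 v)"

text \<open>Continuous functions on the one-point compactification of \<open>Y\<close>, identified with their
  restrictions to \<open>Y\<close>.\<close>

definition cont_compactification :: "'a::real_normed_vector set \<Rightarrow> ('a \<Rightarrow> real) set" where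
  "cont_compactification Y =
     {\<phi>. continuous_on Y \<phi> \<and> (\<exists>L. (\<phi> \<longlongrightarrow> L) (inf at_infinity (principal Y)))}"

definition borel_probs :: "'a::topological_space set \<Rightarrow> 'a measure set" where
  "borel_probs G = {\<gamma>. prob_space \<gamma> \<and> sets \<gamma> = sets (restrict_space borel G)}"

definition W_set ::
  "'a::real_normed_vector set \<Rightarrow> ('a \<Rightarrow> 'u::metric_space set) \<Rightarrow> ('a \<times> 'u \<Rightarrow> 'a) \<Rightarrow>
   ('a \<times> 'u) measure set" where
  "W_set Y U f =
     {\<gamma> \<in> borel_probs (pairs_G Y U f).
        \<forall>\<phi>\<in>cont_compactification Y. (\<integral>(y, u). \<phi> (f (y, u)) - \<phi> y \<partial>\<gamma>) = 0}"

definition g_star ::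
  "'a::real_normed_vector set \<Rightarrow> ('a \<Rightarrow> 'u::metric_space set) \<Rightarrow> ('a \<times> 'u \<Rightarrow> 'a) \<Rightarrow>
   ('a \<times> 'u \<Rightarrow> real) \<Rightarrow> real" where
  "g_star Y U f g = (INF \<gamma>\<in>W_set Y U f. \<integral>p. g p \<partial>\<gamma>)"

end

theory Submission
  imports Defs "HOL-Real_Asymp.Real_Asymp"
begin

text \<open>
  Let \<open>h \<alpha>\<close> and \<open>v S\<close> be the minimal normalised costs of the discounted problem and of the
  problem on \<open>S\<close> steps. Two inequalities connect them with the value of the linear program.

  \<^emph>\<open>Upper bound, for every \<open>\<alpha>\<close> and \<open>S\<close>.\<close> Let \<open>w k\<close> be the optimal cost of the \<open>k\<close>-step problem
  with discount factor \<open>\<alpha> \<le> 1\<close>. Dynamic programming gives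
  \<open>w (k + 1) y \<le> g (y, u) + \<alpha> w k (f (y, u))\<close> on \<open>G\<close>. The constraint that defines \<open>W\<close> says that \<open>f\<close>
  and the projection to \<open>Y\<close> push a measure \<open>\<gamma> \<in> W\<close> forward to the same measure
  (\<open>W_marginals_eq\<close>); hence \<open>\<integral>w k (f (y, u)) d\<gamma> = \<integral>w k y d\<gamma>\<close>, and the inequality integrates and
  iterates to \<open>\<integral>w k d\<gamma> \<le> (1 + \<alpha> + \<dots> + \<alpha>^(k - 1)) \<integral>g d\<gamma>\<close>. The left-hand side is at least the
  minimum of the \<open>k\<close>-step cost. With \<open>\<alpha> = 1\<close> and \<open>k = S\<close> this is \<open>v S \<le> \<integral>g d\<gamma>\<close>; with
  \<open>\<alpha> < 1\<close> and \<open>k \<longlongrightarrow> \<infinity>\<close> it is \<open>h \<alpha> \<le> \<integral>g d\<gamma>\<close>. The point that needs care is that \<open>w k\<close> is Borel: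
  its sublevel sets are closed because the graph \<open>G\<close> is closed and the controls lie in a compact
  set (\<open>bellman_sublevel_closed_seq\<close>).

  \<^emph>\<open>Lower bound, in the limit.\<close> The cost of an optimal process is the integral of \<open>g\<close> against its
  occupational measure, the law of \<open>(y(t), u(t))\<close> at a random time \<open>t\<close> that is geometric with
  parameter \<open>1 - \<alpha>\<close>, respectively uniform on \<open>{0, \<dots>, S - 1}\<close>. These laws live on the compact
  closure of \<open>D\<close>, so along any sequence with \<open>\<alpha> \<longlongrightarrow> 1\<close> or \<open>S \<longlongrightarrow> \<infinity>\<close> a subsequence converges weakly.
  The expected increment of a bounded function along the process is of order \<open>1 - \<alpha>\<close>,
  respectively \<open>1 / S\<close>, so the limit lies in \<open>W\<close> and the costs converge to \<open>\<integral>g d\<gamma> \<ge> g\<^sup>*\<close>. Together with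
  the upper bound this forces convergence to \<open>g\<^sup>*\<close> (\<open>occupational_values_tendsto_g_star\<close>).

  Weak compactness is reduced to Helly's selection theorem on the real line: a compact metric
  space is a continuous image of a compact set of reals
  (\<open>compact_metric_continuous_image_of_real\<close>), the discrete laws lift to this set point by point,
  and the limit measure is pushed forward again.
\<close>

section \<open>Compact metric spaces as continuous images of compact sets of reals\<close>

text \<open>Finite covers by balls of radius \<open>1 / (n + 1)\<close>, for all \<open>n\<close>, are listed in one sequence. The
  initial segments of this sequence know every point up to a prescribed error, so membership in
  its sets can serve as a sequence of binary digits.\<close>

lemma compact_cover_sequence:
  fixes K :: "'a::metric_space set"
  assumes "compact K"
  obtains B :: "nat \<Rightarrow> 'a set" where
    "\<And>e. e > 0 \<Longrightarrow> \<exists>N. \<forall>p\<in>K. \<exists>i\<le>N. p \<in> B i \<and> (\<forall>x\<in>B i. \<forall>y\<in>B i. dist x y < e)"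
proof -
  have "\<exists>F. finite F \<and> K \<subseteq> (\<Union>x\<in>F. ball x (1 / real (Suc n)))" for n
    using assms unfolding compact_eq_totally_bounded by (metis of_nat_0_less_iff zero_less_Suc zero_less_divide_1_iff)
  then obtain F where F: "\<And>n. finite (F n)" "\<And>n. K \<subseteq> (\<Union>x\<in>F n. ball x (1 / real (Suc n)))"
    by metis
  define C where "C = (\<Union>n. (\<lambda>x. ball x (1 / real (Suc n))) ` F n)"
  have C: "countable C"
    unfolding C_def using F(1) by (intro countable_UN) (auto intro: countable_finite)
  show thesis
  proof (rule that[of "from_nat_into C"])
    fix e :: real assume "e > 0"
    then obtain n where "inverse (real (Suc n)) < e / 2"
      using reals_Archimedean[of "e / 2"] by auto
    then have n: "2 * (1 / real (Suc n)) < e"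
      by (simp add: field_simps)
    let ?b = "\<lambda>x. ball x (1 / real (Suc n))"
    have "finite (to_nat_on C ` ?b ` F n)"
      using F(1) by auto
    then obtain N where N: "\<forall>i\<in>to_nat_on C ` ?b ` F n. i \<le> N"
      unfolding finite_nat_set_iff_bounded_le by auto
    have "\<exists>i\<le>N. p \<in> from_nat_into C i \<and> (\<forall>x\<in>from_nat_into C i. \<forall>y\<in>from_nat_into C i. dist x y < e)"
      if p: "p \<in> K" for p
    proof -
      obtain z where z: "z \<in> F n" "p \<in> ?b z"
        using F(2)[of n] p by blast
      then have "?b z \<in> C"
        unfolding C_def by blast
      then have eq: "from_nat_into C (to_nat_on C (?b z)) = ?b z"
        using C by simp
      have "dist x y < e" if "x \<in> ?b z" "y \<in> ?b z" for x y
        using that n dist_triangle3[of x y z] by auto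
      with eq z N show ?thesis
        by (intro exI[of _ "to_nat_on C (?b z)"]) auto
    qed
    then show "\<exists>N. \<forall>p\<in>K. \<exists>i\<le>N. p \<in> from_nat_into C i \<and>
        (\<forall>x\<in>from_nat_into C i. \<forall>y\<in>from_nat_into C i. dist x y < e)"
      by blast
  qed
qed

text \<open>Digits \<open>0\<close> and \<open>1\<close> in base \<open>3\<close> rather than \<open>2\<close>: the gaps of the resulting Cantor set make the
  digits continuous functions of the number.\<close>

definition ternary :: "(nat \<Rightarrow> bool) \<Rightarrow> real" where
  "ternary s = (\<Sum>i. of_bool (s i) * (1/3) ^ i)"

lemma summable_ternary: "summable (\<lambda>i. of_bool (s i) * (1/3 :: real) ^ i)"
  by (rule summable_comparison_test[OF _ summable_geometric[of "1/3::real"]]) auto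

lemma ternary_bounds: "0 \<le> ternary s" "ternary s \<le> 3/2"
proof -
  show "0 \<le> ternary s"
    unfolding ternary_def by (intro suminf_nonneg summable_ternary) auto
  have "ternary s \<le> (\<Sum>i. (1/3) ^ i)"
    unfolding ternary_def by (intro suminf_le summable_ternary summable_geometric) auto
  also have "\<dots> = 3/2"
    by (subst suminf_geometric) auto
  finally show "ternary s \<le> 3/2" .
qed

text \<open>At the first differing digit \<open>j\<close> the expansions are \<open>3^(-j)\<close> apart, and all later digits
  together can make up for only half of this.\<close>

lemma ternary_close_imp_digits_eq:
  assumes close: "\<bar>ternary s - ternary s'\<bar> < (1/3) ^ N / 2" and "i \<le> N"
  shows "s i = s' i"
proof (rule ccontr)
  assume neq: "s i \<noteq> s' i"
  define j where "j = (LEAST j. s j \<noteq> s' j)"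
  have j: "s j \<noteq> s' j" and below: "\<And>k. k < j \<Longrightarrow> s k = s' k" and "j \<le> i"
    unfolding j_def using LeastI[of "\<lambda>j. s j \<noteq> s' j", OF neq] Least_le[of "\<lambda>j. s j \<noteq> s' j", OF neq]
    by (blast dest: not_less_Least)+
  define d :: "nat \<Rightarrow> real" where "d k = of_bool (s k) * (1/3)^k - of_bool (s' k) * (1/3) ^ k" for k
  have d: "summable d" "ternary s - ternary s' = suminf d"
    unfolding d_def[abs_def] ternary_def
    by (simp_all add: summable_diff suminf_diff summable_ternary)
  have le: "\<bar>d k\<bar> \<le> (1/3)^k" for k
    by (auto simp: d_def of_bool_def)
  have split: "suminf d = (\<Sum>k. d (k + Suc j)) + d j"
    using suminf_split_initial_segment[OF d(1), of "Suc j"] below by (simp add: d_def)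
  have "\<bar>\<Sum>k. d (k + Suc j)\<bar> \<le> (\<Sum>k. (1/3) ^ (k + Suc j))"
  proof -
    have "summable (\<lambda>k. (1/3::real) ^ (k + Suc j))"
      by (subst summable_iff_shift) (auto intro: summable_geometric)
    moreover from this have "summable (\<lambda>k. \<bar>d (k + Suc j)\<bar>)"
      by (rule summable_comparison_test[rotated]) (use le[of "_ + Suc j"] in auto)
    ultimately show ?thesis
      using summable_rabs[of "\<lambda>k. d (k + Suc j)"] suminf_le[of "\<lambda>k. \<bar>d (k + Suc j)\<bar>"] le
      by (meson order_trans)
  qed
  also have "(\<Sum>k. (1/3::real) ^ (k + Suc j)) = (1/3) ^ j / 2"
    using suminf_mult2[OF summable_geometric[of "1/3::real"], of "(1/3) ^ Suc j"]
    by (simp add: power_add suminf_geometric)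
  finally have "\<bar>d j\<bar> - (1/3)^j / 2 \<le> \<bar>ternary s - ternary s'\<bar>"
    unfolding d split by linarith
  moreover have "\<bar>d j\<bar> = (1/3) ^ j"
    using j by (auto simp: d_def)
  moreover have "(1/3 :: real) ^ N \<le> (1/3) ^ j"
    using \<open>j \<le> i\<close> \<open>i \<le> N\<close> by (intro power_decreasing) auto
  ultimately show False
    using close by linarith
qed

text \<open>The theorem of Hausdorff and Alexandroff. Coding a point by its memberships in a sequence of
  small covers gives an injection \<open>c\<close> into the reals that need not be continuous, but its inverse is
  uniformly continuous: nearby codes share their first digits, hence their points share a small
  cover set. This estimate survives the passage to the closure \<open>R\<close> of the graph of \<open>c\<close>, which is
  therefore the graph of a continuous function on a compact set of reals.\<close>

lemma compact_metric_continuous_image_of_real: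
  fixes K :: "'a::metric_space set"
  assumes K: "compact K"
  obtains C :: "real set" and h where "compact C" "continuous_on C h" "h ` C = K"
proof -
  obtain B :: "nat \<Rightarrow> 'a set" where B:
    "\<And>e. e > 0 \<Longrightarrow> \<exists>N. \<forall>p\<in>K. \<exists>i\<le>N. p \<in> B i \<and> (\<forall>x\<in>B i. \<forall>y\<in>B i. dist x y < e)"
    using compact_cover_sequence[OF K] by metis
  define c where "c p = ternary (\<lambda>i. p \<in> B i)" for p
  have sep: "\<exists>d>0. \<forall>p\<in>K. \<forall>q\<in>K. \<bar>c p - c q\<bar> < d \<longrightarrow> dist p q < e" if e: "e > 0" for e
  proof -
    obtain N where N: "\<forall>p\<in>K. \<exists>i\<le>N. p \<in> B i \<and> (\<forall>x\<in>B i. \<forall>y\<in>B i. dist x y < e)"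
      using B[OF e] by blast
    have "dist p q < e" if "p \<in> K" "q \<in> K" "\<bar>c p - c q\<bar> < (1/3) ^ N / 2" for p q
      using N that ternary_close_imp_digits_eq[of "\<lambda>i. p \<in> B i" "\<lambda>i. q \<in> B i" N]
      unfolding c_def by blast
    then show ?thesis
      by (intro exI[of _ "(1/3) ^ N / 2"]) auto
  qed
  define R where "R = closure ((\<lambda>p. (c p, p)) ` K)"
  have sepR: "\<exists>d>0. \<forall>s p t q. (s, p) \<in> R \<longrightarrow> (t, q) \<in> R \<longrightarrow> \<bar>s - t\<bar> < d \<longrightarrow> dist p q < e"
    if e: "e > 0" for e
  proof -
    obtain d where d: "d > 0" "\<forall>p\<in>K. \<forall>q\<in>K. \<bar>c p - c q\<bar> < d \<longrightarrow> dist p q < e / 2"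
      using sep[of "e/2"] e by auto
    \<comment> \<open>Points of \<open>R\<close> are approximated by points of the graph of \<open>c\<close> up to \<open>r\<close>; the constants leave
      room for two such errors in both coordinates.\<close>
    have "dist p q < e" if R: "(s, p) \<in> R" "(t, q) \<in> R" and st: "\<bar>s - t\<bar> < d / 2" for s p t q
    proof -
      define r where "r = min (d / 4) (e / 4)"
      have r: "r > 0" "r \<le> d / 4" "r \<le> e / 4"
        using d(1) e by (auto simp: r_def)
      obtain p' where p': "p' \<in> K" "dist (c p', p') (s, p) < r"
        using R(1) r(1) unfolding R_def closure_approachable by auto
      obtain q' where q': "q' \<in> K" "dist (c q', q') (t, q) < r"
        using R(2) r(1) unfolding R_def closure_approachable by auto
      have 1: "dist (c p') s < r" "dist p' p < r"
        using p' dist_fst_le[of "(c p', p')" "(s, p)"] dist_snd_le[of "(c p', p')" "(s, p)"] by auto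
      have 2: "dist (c q') t < r" "dist q' q < r"
        using q' dist_fst_le[of "(c q', q')" "(t, q)"] dist_snd_le[of "(c q', q')" "(t, q)"] by auto
      have "\<bar>c p' - c q'\<bar> < d"
        using 1(1) 2(1) st r(2) unfolding dist_real_def by linarith
      then have "dist p' q' < e / 2"
        using d p' q' by auto
      moreover have "dist p q \<le> dist p' p + dist p' q' + dist q' q"
        using dist_triangle[of p q p'] dist_triangle[of p' q q'] by (simp add: dist_commute)
      ultimately show ?thesis
        using 1 2 r by linarith
    qed
    then show ?thesis
      using d(1) by (intro exI[of _ "d/2"]) auto
  qed
  have c_bounds: "0 \<le> c p" "c p \<le> 3/2" for p
    unfolding c_def by (rule ternary_bounds)+
  have R_subset: "R \<subseteq> {0..3/2} \<times> K"
    unfolding R_def using K c_bounds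
    by (intro closure_minimal closed_Times) (auto intro: compact_imp_closed)
  then have "R = ({0..3/2} \<times> K) \<inter> R"
    by blast
  moreover have "compact (({0..3/2} \<times> K) \<inter> R)"
    unfolding R_def by (intro compact_Int_closed compact_Times compact_Icc K closed_closure)
  ultimately have "compact R"
    by (rule ssubst)
  define h where "h s = (SOME p. (s, p) \<in> R)" for s
  have hR: "(s, h s) \<in> R" if "s \<in> fst ` R" for s
  proof -
    obtain p where "(s, p) \<in> R" using \<open>s \<in> fst ` R\<close> by force
    then show ?thesis unfolding h_def by (rule someI)
  qed
  have h_eq: "h s = p" if "(s, p) \<in> R" for s p
  proof (rule ccontr)
    assume "h s \<noteq> p"
    then obtain d where d: "d > 0"
      "\<forall>s' p' t q. (s', p') \<in> R \<longrightarrow> (t, q) \<in> R \<longrightarrow> \<bar>s' - t\<bar> < d \<longrightarrow> dist p' q < dist (h s) p"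
      using sepR[of "dist (h s) p"] by auto
    have "s \<in> fst ` R" using that by force
    from d(2)[rule_format, OF hR[OF this] that] d(1) show False by simp
  qed
  show thesis
  proof (rule that)
    show "compact (fst ` R)"
      by (intro compact_continuous_image \<open>compact R\<close> continuous_intros)
    show "continuous_on (fst ` R) h"
      unfolding continuous_on_iff
    proof (intro ballI allI impI)
      fix s e assume s: "s \<in> fst ` R" and "(e::real) > 0"
      then obtain d where "d > 0"
        "\<forall>s p t q. (s, p) \<in> R \<longrightarrow> (t, q) \<in> R \<longrightarrow> \<bar>s - t\<bar> < d \<longrightarrow> dist p q < e"
        using sepR by blast
      then have "dist (h t) (h s) < e" if "t \<in> fst ` R" "dist t s < d" for t
        using hR[OF that(1)] hR[OF s] that(2) unfolding dist_real_def by blast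
      then show "\<exists>d>0. \<forall>t\<in>fst ` R. dist t s < d \<longrightarrow> dist (h t) (h s) < e"
        using \<open>d > 0\<close> by blast
    qed
    show "h ` fst ` R = K"
    proof
      show "h ` fst ` R \<subseteq> K"
      proof (rule image_subsetI)
        fix s assume "s \<in> fst ` R"
        from subsetD[OF R_subset hR[OF this]] show "h s \<in> K" by (rule SigmaD2)
      qed
      have "p \<in> h ` fst ` R" if "p \<in> K" for p
      proof -
        have "(c p, p) \<in> R"
          unfolding R_def by (rule subsetD[OF closure_subset]) (rule imageI[OF that])
        then have "h (c p) = p" "c p \<in> fst ` R"
          using h_eq by (auto intro: rev_image_eqI)
        then show ?thesis by (metis imageI)
      qed
      then show "K \<subseteq> h ` fst ` R" by blast
    qed
  qed
qed

section \<open>Limits of discrete laws on a compact metric space\<close>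

text \<open>Sequential weak compactness of laws on a compact metric space, for laws that are images of
  discrete distributions. Discreteness makes the lift to the real line trivial: every point may be
  replaced by any one of its preimages under the parametrisation \<open>h\<close>, with no measurable
  selection. The limit is formed as a measure on \<open>G\<close> and tested against functions that are
  continuous on \<open>G\<close> only.\<close>

lemma pmf_laws_on_compact_convergent_subseq:
  fixes P :: "nat \<Rightarrow> 'i pmf" and x :: "nat \<Rightarrow> 'i \<Rightarrow> 'b::metric_space"
  assumes K: "compact K" "K \<subseteq> G"
    and xK: "\<And>n i. i \<in> set_pmf (P n) \<Longrightarrow> x n i \<in> K"
  obtains r \<gamma> where "strict_mono (r :: nat \<Rightarrow> nat)" "\<gamma> \<in> borel_probs G"
    "\<And>\<phi>. continuous_on G \<phi> \<Longrightarrow>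
      (\<lambda>n. \<integral>i. (\<phi> (x (r n) i) :: real) \<partial>measure_pmf (P (r n))) \<longlonglongrightarrow> (\<integral>p. \<phi> p \<partial>\<gamma>)"
proof -
  obtain C :: "real set" and h where C: "compact C" "continuous_on C h" "h ` C = K"
    using compact_metric_continuous_image_of_real[OF K(1)] by metis
  then have "\<exists>s\<in>C. h s = p" if "p \<in> K" for p
    using that by blast
  then obtain c where c: "\<And>p. p \<in> K \<Longrightarrow> c p \<in> C" "\<And>p. p \<in> K \<Longrightarrow> h (c p) = p"
    by metis
  define \<mu> where "\<mu> n = distr (measure_pmf (P n)) borel (\<lambda>i. c (x n i))" for n
  have \<mu>: "real_distribution (\<mu> n)" for n
    unfolding \<mu>_def by (intro prob_space.real_distribution_distr measure_pmf.prob_space_axioms) simp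
  have int_\<mu>: "(\<integral>s. \<phi> s \<partial>\<mu> n) = (\<integral>i. \<phi> (c (x n i)) \<partial>measure_pmf (P n))"
    if "\<phi> \<in> borel_measurable borel" for \<phi> :: "real \<Rightarrow> real" and n
    unfolding \<mu>_def using that by (subst integral_distr) auto
  obtain b where b: "\<And>s. s \<in> C \<Longrightarrow> \<bar>s\<bar> \<le> b"
    using compact_imp_bounded[OF C(1)] unfolding bounded_iff by auto
  have "measure (\<mu> n) {- (\<bar>b\<bar> + 1)<..\<bar>b\<bar> + 1} = 1" for n
  proof -
    have "AE i in measure_pmf (P n). c (x n i) \<in> {- (\<bar>b\<bar> + 1)<..\<bar>b\<bar> + 1}"
    proof (rule AE_pmfI)
      fix i assume "i \<in> set_pmf (P n)"
      from b[OF c(1)[OF xK[OF this]]] show "c (x n i) \<in> {- (\<bar>b\<bar> + 1)<..\<bar>b\<bar> + 1}"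
        by auto
    qed
    then have "AE s in \<mu> n. s \<in> {- (\<bar>b\<bar> + 1)<..\<bar>b\<bar> + 1}"
      unfolding \<mu>_def by (subst AE_distr_iff) auto
    interpret real_distribution "\<mu> n" by (rule \<mu>)
    show ?thesis
      using \<open>AE s in \<mu> n. _\<close> by (subst prob_eq_1) auto
  qed
  then have "tight \<mu>"
    unfolding tight_def using \<mu>
    by (intro conjI allI impI exI[of _ "- (\<bar>b\<bar> + 1)"] exI[of _ "\<bar>b\<bar> + 1"]) auto
  from tight_imp_convergent_subsubsequence[OF this strict_mono_id]
  obtain r M where r: "strict_mono (r :: nat \<Rightarrow> nat)" and M: "real_distribution M"
    and conv: "weak_conv_m (\<mu> \<circ> r) M"
    by (auto simp: comp_def id_def)
  interpret M: real_distribution M by fact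
  have int_conv: "(\<lambda>n. \<integral>i. \<phi> (c (x (r n) i)) \<partial>measure_pmf (P (r n))) \<longlonglongrightarrow> (\<integral>s. \<phi> s \<partial>M)"
    if "continuous_on UNIV \<phi>" "\<And>s. \<bar>\<phi> s\<bar> \<le> B" for \<phi> :: "real \<Rightarrow> real" and B
  proof -
    have "(\<lambda>n. integral\<^sup>L ((\<mu> \<circ> r) n) \<phi>) \<longlonglongrightarrow> integral\<^sup>L M \<phi>"
      using that \<mu> by (intro weak_conv_imp_integral_bdd_continuous_conv[OF _ M conv, of \<phi> B])
        (auto simp: continuous_on_eq_continuous_at)
    then show ?thesis
      using that by (simp add: int_\<mu> borel_measurable_continuous_onI)
  qed
  have "set_pmf (P 0) \<noteq> {}" by (rule set_pmf_not_empty)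
  then have "C \<noteq> {}" using xK c by blast
  \<comment> \<open>The distance to \<open>C\<close>, cut off at \<open>1\<close>, has mean zero under the lifted laws, hence under \<open>M\<close>.\<close>
  have M_C: "AE s in M. s \<in> C"
  proof -
    let ?d = "\<lambda>s. min 1 (infdist s C)"
    have lim: "(\<lambda>n. \<integral>i. ?d (c (x (r n) i)) \<partial>measure_pmf (P (r n))) \<longlonglongrightarrow> (\<integral>s. ?d s \<partial>M)"
      by (rule int_conv[of _ 1]) (auto intro!: continuous_intros simp: infdist_nonneg)
    have zero: "(\<integral>i. ?d (c (x (r n) i)) \<partial>measure_pmf (P (r n))) = 0" for n
      by (rule integral_eq_zero_AE) (use xK c in \<open>auto intro!: AE_pmfI\<close>)
    have "(\<integral>s. ?d s \<partial>M) = 0"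
      using lim unfolding zero by (rule LIMSEQ_unique) (rule tendsto_const)
    moreover have "integrable M ?d"
    proof (rule M.integrable_const_bound[of _ 1])
      have "?d \<in> borel_measurable borel"
        by (intro borel_measurable_continuous_onI continuous_intros)
      then show "?d \<in> borel_measurable M" by simp
    qed (auto simp: infdist_nonneg)
    ultimately have "AE s in M. ?d s = 0"
      by (subst (asm) integral_nonneg_eq_0_iff_AE) (auto simp: infdist_nonneg)
    then show ?thesis
    proof eventually_elim
      case (elim s)
      then show ?case
        using in_closed_iff_infdist_zero[of C s] C(1) \<open>C \<noteq> {}\<close>
        by (auto simp: compact_imp_closed min_def split: if_splits)
    qed
  qed
  have Cb: "C \<in> sets borel" 
    by (rule borel_closed[OF compact_imp_closed[OF C(1)]])
  define M' where "M' = restrict_space M C"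
  have "prob_space M'"
    unfolding M'_def using M_C Cb by (intro prob_space_restrict_space M.emeasure_eq_1_AE) auto
  have sets_M': "sets M' = sets (restrict_space borel C)"
    unfolding M'_def by (intro sets_restrict_space_cong) simp
  have h: "h \<in> measurable M' (restrict_space borel G)"
  proof -
    have "h \<in> measurable (restrict_space borel C) borel"
      using C(2) by (rule borel_measurable_continuous_on_restrict)
    then show ?thesis
      unfolding measurable_cong_sets[OF sets_M' refl] using C K
      by (intro measurable_restrict_space2) (auto simp: space_restrict_space)
  qed
  define \<gamma> where "\<gamma> = distr M' (restrict_space borel G) h"
  show thesis
  proof (rule that[OF r])
    show "\<gamma> \<in> borel_probs G"
      unfolding borel_probs_def \<gamma>_def using \<open>prob_space M'\<close> h by (auto intro: prob_space.prob_space_distr)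
    fix \<phi> :: "'b \<Rightarrow> real" assume \<phi>: "continuous_on G \<phi>"
    have \<phi>h: "continuous_on C (\<lambda>s. \<phi> (h s))"
      using C K by (intro continuous_on_compose2[OF \<phi> C(2)]) auto
    then have "bounded ((\<lambda>s. \<phi> (h s)) ` C)"
      using C(1) by (intro compact_imp_bounded compact_continuous_image)
    then obtain B where B: "\<And>s. s \<in> C \<Longrightarrow> \<bar>\<phi> (h s)\<bar> \<le> B" "0 \<le> B"
      unfolding bounded_iff using \<open>C \<noteq> {}\<close> by fastforce
    \<comment> \<open>Convergence is known for functions on the whole line, so the pullback of \<open>\<phi>\<close> to \<open>C\<close> is extended
      by Tietze's theorem.\<close>
    obtain \<psi> where \<psi>: "continuous_on UNIV \<psi>" "\<And>s. s \<in> C \<Longrightarrow> \<psi> s = \<phi> (h s)" "\<And>s. \<bar>\<psi> s\<bar> \<le> B"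
      using Tietze[OF \<phi>h, of UNIV B] B C(1) by (auto simp: compact_imp_closed)
    have "(\<integral>p. \<phi> p \<partial>\<gamma>) = (\<integral>s. \<phi> (h s) \<partial>M')"
      unfolding \<gamma>_def using h
      by (intro integral_distr borel_measurable_continuous_on_restrict \<phi>)
    also have "\<dots> = (\<integral>s. indicator C s *\<^sub>R \<phi> (h s) \<partial>M)"
      unfolding M'_def using Cb by (intro integral_restrict_space) auto
    also have "\<dots> = (\<integral>s. indicator C s *\<^sub>R \<psi> s \<partial>M)"
      using \<psi> by (intro Bochner_Integration.integral_cong) (auto simp: indicator_def)
    also have "\<dots> = (\<integral>s. \<psi> s \<partial>M)"
    proof (rule integral_cong_AE)
      have "\<psi> \<in> borel_measurable borel"
        using \<psi>(1) by (rule borel_measurable_continuous_onI)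
      then show "\<psi> \<in> borel_measurable M" by simp
      then show "(\<lambda>s. indicator C s *\<^sub>R \<psi> s) \<in> borel_measurable M"
        using Cb by (intro borel_measurable_scaleR borel_measurable_indicator) auto
      show "AE s in M. indicator C s *\<^sub>R \<psi> s = \<psi> s"
        using M_C by eventually_elim simp
    qed
    finally have "(\<integral>p. \<phi> p \<partial>\<gamma>) = (\<integral>s. \<psi> s \<partial>M)" .
    moreover have "(\<integral>i. \<phi> (x n i) \<partial>measure_pmf (P n)) = (\<integral>i. \<psi> (c (x n i)) \<partial>measure_pmf (P n))" for n
      using xK c \<psi>(2) by (intro integral_cong_AE AE_pmfI) auto
    ultimately show "(\<lambda>n. \<integral>i. \<phi> (x (r n) i) \<partial>measure_pmf (P (r n))) \<longlonglongrightarrow> (\<integral>p. \<phi> p \<partial>\<gamma>)"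
      using int_conv[OF \<psi>(1,3)] by simp
  qed
qed

section \<open>Discounted and uniform time averages\<close>

lemma
  fixes a :: "nat \<Rightarrow> real"
  assumes \<alpha>: "0 < \<alpha>" "\<alpha> < 1" and a: "\<And>t. \<bar>a t\<bar> \<le> B"
  shows summable_discounted: "summable (\<lambda>t. \<alpha> ^ t * a t)"
    and expectation_geometric_pmf_discounted:
      "(\<integral>t. a t \<partial>measure_pmf (geometric_pmf (1 - \<alpha>))) = (1 - \<alpha>) * (\<Sum>t. \<alpha> ^ t * a t)"
proof -
  have "summable (\<lambda>t. norm (\<alpha> ^ t * a t))"
  proof (rule summable_comparison_test)
    show "\<exists>N. \<forall>t\<ge>N. norm (norm (\<alpha> ^ t * a t)) \<le> \<alpha> ^ t * B"
      using \<alpha> a by (auto simp: abs_mult)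
    show "summable (\<lambda>t. \<alpha> ^ t * B)"
      using \<alpha> by (intro summable_mult2 summable_geometric) auto
  qed
  then have norm: "summable (\<lambda>t. norm ((1 - \<alpha>) * (\<alpha> ^ t * a t)))"
    unfolding norm_mult[of "1 - \<alpha>"] by (rule summable_mult)
  show sum: "summable (\<lambda>t. \<alpha> ^ t * a t)"
    by (rule summable_norm_cancel) fact
  have "(\<integral>t. a t \<partial>measure_pmf (geometric_pmf (1 - \<alpha>))) =
      (\<integral>t. pmf (geometric_pmf (1 - \<alpha>)) t *\<^sub>R a t \<partial>count_space UNIV)"
    unfolding measure_pmf_eq_density by (rule integral_density) auto
  also have "\<dots> = (\<integral>t. (1 - \<alpha>) * (\<alpha> ^ t * a t) \<partial>count_space UNIV)"
    using \<alpha> by (intro Bochner_Integration.integral_cong) (auto simp: mult_ac)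
  also have "\<dots> = (\<Sum>t. (1 - \<alpha>) * (\<alpha> ^ t * a t))"
    by (rule integral_count_space_nat) (unfold integrable_count_space_nat_iff, rule norm)
  also have "\<dots> = (1 - \<alpha>) * (\<Sum>t. \<alpha> ^ t * a t)"
    using sum by (rule suminf_mult)
  finally show "(\<integral>t. a t \<partial>measure_pmf (geometric_pmf (1 - \<alpha>))) = (1 - \<alpha>) * (\<Sum>t. \<alpha> ^ t * a t)" .
qed

text \<open>Shifting the time by one multiplies the geometric weights by \<open>\<alpha>\<close>, apart from the weight at
  time \<open>0\<close>. So \<open>E b (t + 1) - E b t = (1 - \<alpha>) (E b (t + 1) - b 0)\<close>.\<close>

lemma expectation_geometric_pmf_increment_bound:
  fixes b :: "nat \<Rightarrow> real"
  assumes \<alpha>: "0 < \<alpha>" "\<alpha> < 1" and b: "\<And>t. \<bar>b t\<bar> \<le> B"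
  shows "\<bar>\<integral>t. b (Suc t) - b t \<partial>measure_pmf (geometric_pmf (1 - \<alpha>))\<bar> \<le> 2 * B * (1 - \<alpha>)"
proof -
  let ?P = "measure_pmf (geometric_pmf (1 - \<alpha>))"
  let ?S1 = "\<Sum>t. \<alpha> ^ t * b (Suc t)"
  have sum: "summable (\<lambda>t. \<alpha> ^ t * b t)" and sum1: "summable (\<lambda>t. \<alpha> ^ t * b (Suc t))"
    by (rule summable_discounted[OF \<alpha>], rule b)+
  have "(\<Sum>t. \<alpha> ^ t * b t) = b 0 + (\<Sum>t. \<alpha> ^ Suc t * b (Suc t))"
    using suminf_split_head[OF sum] by simp
  also have "(\<Sum>t. \<alpha> ^ Suc t * b (Suc t)) = \<alpha> * ?S1"
    using suminf_mult[OF sum1, of \<alpha>] by (simp add: mult.assoc)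
  finally have S0: "(\<Sum>t. \<alpha> ^ t * b t) = b 0 + \<alpha> * ?S1" .
  have "(\<integral>t. b (Suc t) - b t \<partial>?P) = (\<integral>t. b (Suc t) \<partial>?P) - (\<integral>t. b t \<partial>?P)"
    using b by (intro Bochner_Integration.integral_diff measure_pmf.integrable_const_bound[of _ B]) auto
  also have "\<dots> = (1 - \<alpha>) * (?S1 - (b 0 + \<alpha> * ?S1))"
    using expectation_geometric_pmf_discounted[OF \<alpha>, of b B]
      expectation_geometric_pmf_discounted[OF \<alpha>, of "\<lambda>t. b (Suc t)" B] b S0
    by (simp add: right_diff_distrib)
  also have "\<dots> = (1 - \<alpha>) * ((1 - \<alpha>) * ?S1 - b 0)"
    by (simp add: algebra_simps)
  also have "(1 - \<alpha>) * ?S1 = (\<integral>t. b (Suc t) \<partial>?P)"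
    using expectation_geometric_pmf_discounted[OF \<alpha>, of "\<lambda>t. b (Suc t)" B] b by simp
  finally have eq: "(\<integral>t. b (Suc t) - b t \<partial>?P) = (1 - \<alpha>) * ((\<integral>t. b (Suc t) \<partial>?P) - b 0)" .
  have "\<bar>\<integral>t. b (Suc t) \<partial>?P\<bar> \<le> B"
  proof -
    have "\<bar>\<integral>t. b (Suc t) \<partial>?P\<bar> \<le> (\<integral>t. \<bar>b (Suc t)\<bar> \<partial>?P)"
      by (rule integral_abs_bound)
    also have "\<dots> \<le> B"
      using b by (intro measure_pmf.integral_le_const measure_pmf.integrable_const_bound[of _ B]) auto
    finally show ?thesis .
  qed
  then have "\<bar>(\<integral>t. b (Suc t) \<partial>?P) - b 0\<bar> \<le> 2 * B"
    using b[of 0] by linarith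
  then show ?thesis
    unfolding eq using \<alpha> by (simp add: abs_mult mult.commute mult_left_mono)
qed

lemma expectation_uniform_increment:
  fixes b :: "nat \<Rightarrow> real"
  assumes "0 < S"
  shows "(\<integral>t. b (Suc t) - b t \<partial>measure_pmf (pmf_of_set {..<S})) = (b S - b 0) / real S"
  using assms by (subst integral_pmf_of_set) (auto simp: sum_lessThan_telescope lessThan_empty_iff)

lemma INF_eq_minimum:
  fixes h :: "'b \<Rightarrow> real"
  assumes "x \<in> A" "\<And>z. z \<in> A \<Longrightarrow> h x \<le> h z"
  shows "(INF z\<in>A. h z) = h x"
  using assms by (intro cInf_eq_minimum) auto

section \<open>Borel measures determined by functions with bounded support\<close>

text \<open>The indicator of a bounded open box is an increasing limit of continuous functions that vanish
  outside the box, and boxes form an intersection-stable generator. Functions of bounded support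
  suffice, which matters since test functions must have a limit at infinity.\<close>

lemma prob_borel_eqI_bounded_support:
  fixes N1 N2 :: "'a::euclidean_space measure"
  assumes N: "prob_space N1" "prob_space N2" and sets: "sets N1 = sets borel" "sets N2 = sets borel"
    and eq: "\<And>\<phi> :: 'a \<Rightarrow> real. continuous_on UNIV \<phi> \<Longrightarrow> (\<And>x. 0 \<le> \<phi> x) \<Longrightarrow> (\<And>x. \<phi> x \<le> 1) \<Longrightarrow>
      bounded {x. \<phi> x \<noteq> 0} \<Longrightarrow> (\<integral>x. \<phi> x \<partial>N1) = (\<integral>x. \<phi> x \<partial>N2)"
  shows "N1 = N2"
proof (rule measure_eqI_generator_eq)
  let ?E = "range (\<lambda>(a, b). box a b :: 'a set)"
  show "Int_stable ?E"
    by (auto simp: Int_stable_def box_Int_box)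
  show "?E \<subseteq> Pow UNIV" "sets N1 = sigma_sets UNIV ?E" "sets N2 = sigma_sets UNIV ?E"
    by (simp_all add: borel_eq_box sets)
  let ?A = "\<lambda>n::nat. box (- (real n *\<^sub>R One)) (real n *\<^sub>R One) :: 'a set"
  show "range ?A \<subseteq> ?E" "(\<Union>i. ?A i) = UNIV"
    unfolding UN_box_eq_UNIV by auto
  interpret N1: prob_space N1 by fact
  interpret N2: prob_space N2 by fact
  show "emeasure N1 (?A i) \<noteq> \<infinity>" for i by simp
  fix S assume "S \<in> ?E"
  then have S: "open S" "bounded S" by auto
  then have "- S \<noteq> {}"
    using not_bounded_UNIV by (metis Compl_empty_eq double_complement)
  define \<phi> where "\<phi> n x = min 1 (real n * infdist x (- S))" for n x
  have \<phi>_cont: "continuous_on UNIV (\<phi> n)" for n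
    unfolding \<phi>_def by (intro continuous_intros)
  have \<phi>_range: "0 \<le> \<phi> n x" "\<phi> n x \<le> 1" for n x
    unfolding \<phi>_def by (auto simp: infdist_nonneg)
  have "\<phi> n x = 0" if "x \<notin> S" for n x
    using that unfolding \<phi>_def by simp
  then have "{x. \<phi> n x \<noteq> 0} \<subseteq> S" for n
    by blast
  then have \<phi>_bdd: "bounded {x. \<phi> n x \<noteq> 0}" for n
    using S(2) bounded_subset by blast
  have \<phi>_lim: "(\<lambda>n. \<phi> n x) \<longlonglongrightarrow> indicator S x" for x
  proof (cases "x \<in> S")
    case True
    then have "infdist x (- S) > 0"
      using S(1) \<open>- S \<noteq> {}\<close> by (intro infdist_pos_not_in_closed) auto
    then have "\<forall>\<^sub>F n in sequentially. 1 \<le> real n * infdist x (- S)"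
      by real_asymp
    then have "\<forall>\<^sub>F n in sequentially. \<phi> n x = 1"
      by eventually_elim (simp add: \<phi>_def)
    then show ?thesis
      using True by (simp add: tendsto_eventually)
  qed (simp add: \<phi>_def)
  have S_sets: "S \<in> sets borel"
    using S(1) by (rule borel_open)
  have int_lim: "(\<lambda>n. \<integral>x. \<phi> n x \<partial>N) \<longlonglongrightarrow> measure N S" if "prob_space N" "sets N = sets borel" for N
  proof -
    interpret prob_space N by fact
    have m: "h \<in> borel_measurable N" if "continuous_on UNIV h" for h :: "'a \<Rightarrow> real"
      using that \<open>sets N = _\<close> by (simp add: borel_measurable_continuous_onI cong: measurable_cong_sets)
    have "(\<lambda>n. \<integral>x. \<phi> n x \<partial>N) \<longlonglongrightarrow> (\<integral>x. indicator S x \<partial>N)"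
    proof (rule integral_dominated_convergence[where w="\<lambda>_. 1"])
      show "indicator S \<in> borel_measurable N"
        using S_sets \<open>sets N = _\<close> by (intro borel_measurable_indicator) simp
    qed (use \<phi>_lim \<phi>_range \<phi>_cont m in auto)
    then show ?thesis
      using S_sets \<open>sets N = _\<close> by simp
  qed
  have "measure N1 S = measure N2 S"
    using int_lim[OF N(1) sets(1)] int_lim[OF N(2) sets(2)] eq[OF \<phi>_cont \<phi>_range \<phi>_bdd]
    by (auto intro: LIMSEQ_unique)
  then show "emeasure N1 S = emeasure N2 S"
    by (simp add: N1.emeasure_eq_measure N2.emeasure_eq_measure)
qed

section \<open>The control system and its graph\<close>

lemma traj_case_nat: "traj f y (case_nat u v) (Suc t) = traj f (f (y, u)) v t"
  by (induction t) auto

lemma traj_cong: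
  assumes "\<And>s. s < t \<Longrightarrow> u s = v s"
  shows "traj f y u t = traj f y v t"
  using assms by (induction t) auto

locale control_system =
  fixes Y :: "'a::euclidean_space set"
    and U0 :: "'u::metric_space set"
    and U :: "'a \<Rightarrow> 'u set"
    and f :: "'a \<times> 'u \<Rightarrow> 'a"
    and g :: "'a \<times> 'u \<Rightarrow> real"
    and M :: real
  assumes Y_closed: "closed Y"
    and U0_compact: "compact U0"
    and U_subset: "y \<in> Y \<Longrightarrow> U y \<subseteq> U0"
    and U_compact: "y \<in> Y \<Longrightarrow> compact (U y)"
    and U_usc: "usc_on Y U"
    and f_cont: "continuous_on (UNIV \<times> U0) f"
    and g_cont: "continuous_on (UNIV \<times> U0) g"
    and g_bound: "p \<in> UNIV \<times> U0 \<Longrightarrow> \<bar>g p\<bar> \<le> M"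
    and viable: "y \<in> Y \<Longrightarrow> adm_controls Y U f y \<noteq> {}"
begin

abbreviation G :: "('a \<times> 'u) set" where "G \<equiv> pairs_G Y U f"

lemma G_subset: "G \<subseteq> UNIV \<times> U0"
  using U_subset by (auto simp: pairs_G_def)

lemma G_memD:
  assumes "(y, u) \<in> G"
  shows "y \<in> Y" "u \<in> U0" "f (y, u) \<in> Y" "\<bar>g (y, u)\<bar> \<le> M"
  using assms G_subset g_bound[of "(y, u)"] by (auto simp: pairs_G_def)

lemma f_cont_G: "continuous_on G f" and g_cont_G: "continuous_on G g"
  using f_cont g_cont G_subset by (blast intro: continuous_on_subset)+

text \<open>If \<open>u \<notin> U y\<close>, a closed ball around \<open>u\<close> misses the compact set \<open>U y\<close>, and by upper
  semicontinuity it misses \<open>U z\<close> for all \<open>z\<close> near \<open>y\<close>.\<close>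

lemma closed_G: "closed G"
  unfolding closed_sequential_limits
proof (intro allI impI)
  fix p :: "nat \<Rightarrow> 'a \<times> 'u" and l
  assume "(\<forall>n. p n \<in> G) \<and> p \<longlonglongrightarrow> l"
  then have pG: "\<And>n. p n \<in> G" and lim: "p \<longlonglongrightarrow> l" by auto
  obtain y u where l: "l = (y, u)" by force
  have y_lim: "(\<lambda>n. fst (p n)) \<longlonglongrightarrow> y" and u_lim: "(\<lambda>n. snd (p n)) \<longlonglongrightarrow> u"
    using tendsto_fst[OF lim] tendsto_snd[OF lim] l by auto
  have pn: "fst (p n) \<in> Y" "snd (p n) \<in> U (fst (p n))" "snd (p n) \<in> U0" "f (p n) \<in> Y" for n
    using pG[of n] G_subset by (auto simp: pairs_G_def)
  have y: "y \<in> Y"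
    by (rule closed_sequentially[OF Y_closed _ y_lim]) (use pn in auto)
  have u: "u \<in> U0"
    by (rule closed_sequentially[OF compact_imp_closed[OF U0_compact] _ u_lim]) (use pn in auto)
  have "(\<lambda>n. f (p n)) \<longlonglongrightarrow> f l"
    using u l pn by (intro continuous_on_tendsto_compose[OF f_cont lim]) (auto simp: mem_Times_iff)
  from closed_sequentially[OF Y_closed _ this] have fl: "f l \<in> Y"
    using pn by blast
  have "u \<in> U y"
  proof (rule ccontr)
    assume "u \<notin> U y"
    then obtain e where e: "e > 0" "cball u e \<subseteq> - U y"
      using open_contains_cball[of "- U y"] compact_imp_closed[OF U_compact[OF y]] by auto
    then have "U y \<subseteq> - cball u e" "open (- cball u e)" by auto
    then have "\<forall>\<^sub>F z in at y within Y. U z \<subseteq> - cball u e"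
      using U_usc y unfolding usc_on_def by blast
    then have "\<forall>\<^sub>F z in inf (nhds y) (principal Y). U z \<subseteq> - cball u e"
      using \<open>U y \<subseteq> - cball u e\<close>
      by (auto simp: at_within_def eventually_inf_principal elim!: eventually_mono)
    moreover have "filterlim (\<lambda>n. fst (p n)) (inf (nhds y) (principal Y)) sequentially"
      using y_lim pn by (auto simp: filterlim_inf filterlim_principal)
    ultimately have "\<forall>\<^sub>F n in sequentially. U (fst (p n)) \<subseteq> - cball u e"
      unfolding filterlim_iff by blast
    moreover have "\<forall>\<^sub>F n in sequentially. dist (snd (p n)) u < e"
      using u_lim e(1) by (rule tendstoD)
    ultimately have "\<forall>\<^sub>F n in sequentially. False"
    proof eventually_elim
      case (elim n)
      with pn[of n] show False by (auto simp: dist_commute)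
    qed
    then show False by simp
  qed
  with y fl l show "l \<in> G" by (auto simp: pairs_G_def)
qed

lemma G_section_nonempty:
  assumes "y \<in> Y"
  shows "{u. (y, u) \<in> G} \<noteq> {}"
proof -
  obtain u where "u \<in> adm_controls Y U f y" using viable[OF assms] by blast
  then have "(traj f y u 0, u 0) \<in> G" unfolding adm_controls_def by blast
  then show ?thesis by auto
qed

section \<open>Value iteration\<close>

text \<open>The optimal cost of \<open>k\<close> steps, given by its dynamic programming recursion. The value \<open>\<alpha> = 1\<close>
  covers the problem on a finite horizon, \<open>\<alpha> < 1\<close> the truncations of the discounted problem.
  Outside \<open>Y\<close> no control is admissible, and the infimum over the empty set has no meaning there.\<close>

primrec bellman :: "real \<Rightarrow> nat \<Rightarrow> 'a \<Rightarrow> real" where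
  "bellman \<alpha> 0 = (\<lambda>y. 0)"
| "bellman \<alpha> (Suc k) = (\<lambda>y. INF u\<in>{u. (y, u) \<in> G}. g (y, u) + \<alpha> * bellman \<alpha> k (f (y, u)))"

context
  fixes \<alpha> :: real
  assumes \<alpha>: "0 < \<alpha>" "\<alpha> \<le> 1"
begin

lemma stage_bound:
  assumes "(y, u) \<in> G" "\<bar>w\<bar> \<le> M * real k"
  shows "\<bar>g (y, u) + \<alpha> * w\<bar> \<le> M * real (Suc k)"
proof -
  have "\<bar>\<alpha> * w\<bar> \<le> \<bar>w\<bar>"
    using \<alpha> mult_right_mono[of \<alpha> 1 "\<bar>w\<bar>"] by (simp add: abs_mult)
  then show ?thesis
    using assms(2) G_memD(4)[OF assms(1)] by (simp add: algebra_simps)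
qed

lemma bellman_bound: "y \<in> Y \<Longrightarrow> \<bar>bellman \<alpha> k y\<bar> \<le> M * real k"
proof (induction k arbitrary: y)
  case (Suc k)
  have "\<bar>g (y, u) + \<alpha> * bellman \<alpha> k (f (y, u))\<bar> \<le> M * real (Suc k)" if "(y, u) \<in> G" for u
    using stage_bound[OF that] Suc.IH G_memD[OF that] by blast
  then show ?case
    unfolding bellman.simps using G_section_nonempty[OF Suc.prems] by (intro cInf_abs_ge) auto
qed simp

lemma bellman_bdd_below:
  assumes "y \<in> Y"
  shows "bdd_below ((\<lambda>u. g (y, u) + \<alpha> * bellman \<alpha> k (f (y, u))) ` {u. (y, u) \<in> G})"
proof (rule bdd_belowI2)
  fix u assume "u \<in> {u. (y, u) \<in> G}"
  then have "\<bar>g (y, u) + \<alpha> * bellman \<alpha> k (f (y, u))\<bar> \<le> M * real (Suc k)"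
    using stage_bound bellman_bound G_memD by blast
  then show "- (M * real (Suc k)) \<le> g (y, u) + \<alpha> * bellman \<alpha> k (f (y, u))"
    by linarith
qed

lemma bellman_Suc_le:
  assumes "(y, u) \<in> G"
  shows "bellman \<alpha> (Suc k) y \<le> g (y, u) + \<alpha> * bellman \<alpha> k (f (y, u))"
  unfolding bellman.simps using assms G_memD(1)[OF assms]
  by (intro cINF_lower bellman_bdd_below) auto

text \<open>Lower semicontinuity on \<open>Y\<close>. Almost minimal controls along the sequence have a cluster point by
  compactness of \<open>U0\<close>, it is a control at the limit state because \<open>G\<close> is closed, and the induction
  hypothesis applies to the successor states.\<close>

lemma bellman_sublevel_closed_seq:
  assumes "y \<in> Y" "X \<longlonglongrightarrow> y" "\<And>n. X n \<in> Y" "\<And>n. bellman \<alpha> k (X n) \<le> c"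
  shows "bellman \<alpha> k y \<le> c"
  using assms
proof (induction k arbitrary: y X c)
  case 0
  then show ?case by simp
next
  case (Suc k)
  show ?case
  proof (rule field_le_epsilon)
    fix e :: real assume e: "e > 0"
    have "\<exists>u. (X n, u) \<in> G \<and> g (X n, u) + \<alpha> * bellman \<alpha> k (f (X n, u)) < c + e / 2" for n
    proof -
      have "bellman \<alpha> (Suc k) (X n) < c + e / 2"
        using Suc.prems(4)[of n] e by linarith
      then show ?thesis
        unfolding bellman.simps
        using cINF_less_iff[OF G_section_nonempty bellman_bdd_below, of "X n"] Suc.prems(3)[of n]
        by auto
    qed
    then obtain u where uG: "\<And>n. (X n, u n) \<in> G"
      and u_less: "\<And>n. g (X n, u n) + \<alpha> * bellman \<alpha> k (f (X n, u n)) < c + e / 2"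
      by metis
    \<comment> \<open>Half of the slack \<open>e\<close> went into the choice of the controls; the other half absorbs the error
      in the limit of the stage costs.\<close>
    obtain v r where v: "v \<in> U0" "strict_mono (r :: nat \<Rightarrow> nat)" "(u \<circ> r) \<longlonglongrightarrow> v"
      using U0_compact G_memD(2)[OF uG] unfolding compact_eq_seq_compact_metric seq_compact_def by blast
    define p where "p n = (X (r n), u (r n))" for n
    have p_lim: "p \<longlonglongrightarrow> (y, v)"
      unfolding p_def using LIMSEQ_subseq_LIMSEQ[OF Suc.prems(2) v(2)] v(3)
      by (intro tendsto_Pair) (auto simp: comp_def)
    have pG: "p n \<in> G" for n unfolding p_def by (rule uG)
    have yv: "(y, v) \<in> G"
      by (rule closed_sequentially[OF closed_G _ p_lim]) (use pG in auto)
    have "(\<lambda>n. g (p n)) \<longlonglongrightarrow> g (y, v)"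
      using pG yv by (intro continuous_on_tendsto_compose[OF g_cont_G p_lim]) auto
    then have "\<forall>\<^sub>F n in sequentially. g (y, v) - e / 2 < g (p n)"
      by (rule order_tendstoD) (use e in auto)
    then obtain N where N: "\<And>n. n \<ge> N \<Longrightarrow> g (y, v) - e / 2 < g (p n)"
      unfolding eventually_sequentially by blast
    have "bellman \<alpha> k (f (y, v)) \<le> (c + e - g (y, v)) / \<alpha>"
    proof (rule Suc.IH)
      show "f (y, v) \<in> Y" using G_memD(3)[OF yv] .
      have "(\<lambda>n. f (p n)) \<longlonglongrightarrow> f (y, v)"
        using pG yv by (intro continuous_on_tendsto_compose[OF f_cont_G p_lim]) auto
      then show "(\<lambda>n. f (p (n + N))) \<longlonglongrightarrow> f (y, v)"
        by (rule LIMSEQ_ignore_initial_segment)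
      show "f (p (n + N)) \<in> Y" for n
        using pG[of "n + N"] by (auto simp: pairs_G_def)
      show "bellman \<alpha> k (f (p (n + N))) \<le> (c + e - g (y, v)) / \<alpha>" for n
        using N[of "n + N"] u_less[of "r (n + N)"] \<alpha> by (simp add: p_def pos_le_divide_eq mult.commute)
    qed
    then have "g (y, v) + \<alpha> * bellman \<alpha> k (f (y, v)) \<le> c + e"
      using \<alpha> by (simp add: pos_le_divide_eq mult.commute)
    then show "bellman \<alpha> (Suc k) y \<le> c + e"
      using bellman_Suc_le[OF yv, of k] by linarith
  qed
qed

text \<open>Extension by \<open>0\<close> turns the value into a Borel function on the whole space, where it can be
  integrated against the two push-forwards of a measure on \<open>G\<close>.\<close>

lemma bellman_measurable: "(\<lambda>y. indicator Y y * bellman \<alpha> k y) \<in> borel_measurable borel"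
proof (rule borel_measurableI_le)
  fix c :: real
  have "closed {y \<in> Y. bellman \<alpha> k y \<le> c}"
    unfolding closed_sequential_limits
    using bellman_sublevel_closed_seq Y_closed unfolding closed_sequential_limits by blast
  then have "{y \<in> Y. bellman \<alpha> k y \<le> c} \<union> (if 0 \<le> c then - Y else {}) \<in> sets borel"
    using Y_closed by auto
  also have "{y \<in> Y. bellman \<alpha> k y \<le> c} \<union> (if 0 \<le> c then - Y else {}) =
      {y \<in> space borel. indicator Y y * bellman \<alpha> k y \<le> c}"
    by (auto simp: indicator_def split: if_splits)
  finally show "{y \<in> space borel. indicator Y y * bellman \<alpha> k y \<le> c} \<in> sets borel" .
qed

text \<open>The recursion is bounded below by the true \<open>k\<close>-step costs. The infimum is compared through
  arbitrary lower bounds \<open>c\<close>, so neither minimisers nor almost minimisers need to be chained. Costs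
  are taken along infinite processes, which exist from every state by viability.\<close>

lemma bellman_greatest:
  assumes "y \<in> Y"
    and "\<And>u. u \<in> adm_controls Y U f y \<Longrightarrow> c \<le> (\<Sum>t<k. \<alpha> ^ t * g (traj f y u t, u t))"
  shows "c \<le> bellman \<alpha> k y"
  using assms
proof (induction k arbitrary: y c)
  case 0
  then show ?case using viable[of y] by auto
next
  case (Suc k)
  have "c \<le> g (y, u) + \<alpha> * bellman \<alpha> k (f (y, u))" if u: "(y, u) \<in> G" for u
  proof -
    \<comment> \<open>A process from the successor state, preceded by \<open>u\<close>, is a process from \<open>y\<close>.\<close>
    have "(c - g (y, u)) / \<alpha> \<le> bellman \<alpha> k (f (y, u))"
    proof (rule Suc.IH)
      show "f (y, u) \<in> Y" using G_memD(3)[OF u] .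
      fix v assume v: "v \<in> adm_controls Y U f (f (y, u))"
      have "(traj f y (case_nat u v) t, case_nat u v t) \<in> G" for t
      proof (cases t)
        case 0
        then show ?thesis using u by simp
      next
        case (Suc t)
        then show ?thesis using v unfolding adm_controls_def by (simp add: traj_case_nat del: traj.simps)
      qed
      then have "c \<le> (\<Sum>t<Suc k. \<alpha> ^ t * g (traj f y (case_nat u v) t, case_nat u v t))"
        by (intro Suc.prems) (auto simp: adm_controls_def)
      also have "\<dots> = g (y, u) + \<alpha> * (\<Sum>t<k. \<alpha> ^ t * g (traj f (f (y, u)) v t, v t))"
        by (simp add: sum.lessThan_Suc_shift traj_case_nat sum_distrib_left mult.assoc del: traj.simps(2) sum.lessThan_Suc)
      finally show "(c - g (y, u)) / \<alpha> \<le> (\<Sum>t<k. \<alpha> ^ t * g (traj f (f (y, u)) v t, v t))"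
        using \<alpha> by (simp add: pos_divide_le_eq mult.commute)
    qed
    then show ?thesis
      using \<alpha> by (simp add: pos_divide_le_eq mult.commute)
  qed
  then show ?case
    unfolding bellman.simps using G_section_nonempty[OF Suc.prems(1)] by (intro cINF_greatest) auto
qed

end

section \<open>The linear program bounds the optimal values from above\<close>

abbreviation W :: "('a \<times> 'u) measure set" where "W \<equiv> W_set Y U f"

lemma
  assumes "\<gamma> \<in> borel_probs G"
  shows borel_probs_prob_space: "prob_space \<gamma>"
    and borel_probs_sets: "sets \<gamma> = sets (restrict_space borel G)"
    and borel_probs_space: "space \<gamma> = G"
proof -
  show "prob_space \<gamma>" and *: "sets \<gamma> = sets (restrict_space borel G)"
    using assms by (auto simp: borel_probs_def)
  show "space \<gamma> = G"
    using sets_eq_imp_space_eq[OF *] by (simp add: space_restrict_space)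
qed

lemma borel_probs_measurable:
  assumes "\<gamma> \<in> borel_probs G" "continuous_on G \<phi>"
  shows "\<phi> \<in> borel_measurable \<gamma>"
  using borel_measurable_continuous_on_restrict[OF assms(2)]
  by (simp add: measurable_cong_sets[OF borel_probs_sets[OF assms(1)] refl])

lemma borel_probs_integrable:
  fixes \<phi> :: "'a \<times> 'u \<Rightarrow> real"
  assumes "\<gamma> \<in> borel_probs G" "\<phi> \<in> borel_measurable \<gamma>" "\<And>p. p \<in> G \<Longrightarrow> \<bar>\<phi> p\<bar> \<le> B"
  shows "integrable \<gamma> \<phi>"
proof -
  interpret prob_space \<gamma> using assms(1) by (rule borel_probs_prob_space)
  show ?thesis
    using assms by (intro integrable_const_bound[of _ B]) (auto simp: borel_probs_space)
qed

lemma g_integrable: "\<gamma> \<in> borel_probs G \<Longrightarrow> integrable \<gamma> g"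
  using g_bound G_subset by (intro borel_probs_integrable borel_probs_measurable g_cont_G) auto

lemma fst_cont_G: "continuous_on G fst"
  by (intro continuous_intros)

text \<open>The integral constraint that defines \<open>W\<close> for functions continuous up to infinity extends to all
  Borel functions, in the form of an equality of push-forwards.\<close>

lemma W_marginals_eq:
  assumes "\<gamma> \<in> W"
  shows "distr \<gamma> borel f = distr \<gamma> borel fst"
proof -
  have \<gamma>: "\<gamma> \<in> borel_probs G"
    and inv: "\<And>\<phi>. \<phi> \<in> cont_compactification Y \<Longrightarrow> (\<integral>(y, u). \<phi> (f (y, u)) - \<phi> y \<partial>\<gamma>) = 0"
    using assms by (auto simp: W_set_def)
  interpret prob_space \<gamma> using \<gamma> by (rule borel_probs_prob_space)
  note f_meas = borel_probs_measurable[OF \<gamma> f_cont_G] and fst_meas = borel_probs_measurable[OF \<gamma> fst_cont_G]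
  show ?thesis
  proof (rule prob_borel_eqI_bounded_support)
    show "prob_space (distr \<gamma> borel f)" "prob_space (distr \<gamma> borel fst)"
      using f_meas fst_meas by (auto intro: prob_space_distr)
    fix \<phi> :: "'a \<Rightarrow> real"
    assume \<phi>: "continuous_on UNIV \<phi>" "\<And>x. 0 \<le> \<phi> x" "\<And>x. \<phi> x \<le> 1" "bounded {x. \<phi> x \<noteq> 0}"
    obtain b where b: "\<And>x. \<phi> x \<noteq> 0 \<Longrightarrow> norm x \<le> b"
      using \<phi>(4) unfolding bounded_iff by auto
    have "\<forall>\<^sub>F x in at_infinity. \<phi> x = 0"
      unfolding eventually_at_infinity using b by (intro exI[of _ "b + 1"]) force
    then have "(\<phi> \<longlongrightarrow> 0) (inf at_infinity (principal Y))"
      by (intro tendsto_eventually) (auto simp: eventually_inf_principal elim!: eventually_mono)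
    then have "\<phi> \<in> cont_compactification Y"
      unfolding cont_compactification_def using continuous_on_subset[OF \<phi>(1)] by auto
    then have "(\<integral>p. \<phi> (f p) - \<phi> (fst p) \<partial>\<gamma>) = 0"
      using inv[of \<phi>] by (simp add: case_prod_beta')
    moreover have \<phi>_meas: "\<phi> \<in> borel_measurable borel"
      using \<phi>(1) by (rule borel_measurable_continuous_onI)
    moreover have "integrable \<gamma> (\<lambda>p. \<phi> (f p))" "integrable \<gamma> (\<lambda>p. \<phi> (fst p))"
      using \<phi>(2,3) measurable_compose[OF f_meas \<phi>_meas] measurable_compose[OF fst_meas \<phi>_meas]
      by (auto intro!: borel_probs_integrable[OF \<gamma>, of _ 1])
    ultimately show "(\<integral>x. \<phi> x \<partial>distr \<gamma> borel f) = (\<integral>x. \<phi> x \<partial>distr \<gamma> borel fst)"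
      using f_meas fst_meas by (simp add: integral_distr)
  qed simp_all
qed

text \<open>Integrating the dynamic programming inequality: invariance of \<open>\<gamma>\<close> replaces the value at the
  successor state by the value at the current state.\<close>

lemma bellman_integral_le:
  assumes \<gamma>W: "\<gamma> \<in> W" and \<alpha>: "0 < \<alpha>" "\<alpha> \<le> 1"
  shows "(\<integral>p. bellman \<alpha> k (fst p) \<partial>\<gamma>) \<le> (\<Sum>j<k. \<alpha> ^ j) * (\<integral>p. g p \<partial>\<gamma>)"
proof (induction k)
  case 0
  show ?case by simp
next
  case (Suc k)
  have \<gamma>: "\<gamma> \<in> borel_probs G" using \<gamma>W by (auto simp: W_set_def)
  note f_meas = borel_probs_measurable[OF \<gamma> f_cont_G] and fst_meas = borel_probs_measurable[OF \<gamma> fst_cont_G]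
  let ?h = "\<lambda>k y. indicator Y y * bellman \<alpha> k y"
  have bf: "bellman \<alpha> k (f p) = ?h k (f p)" and bfst: "bellman \<alpha> j (fst p) = ?h j (fst p)"
    if "p \<in> G" for p j
    using that by (auto simp: pairs_G_def)
  have bound: "\<bar>?h j y\<bar> \<le> M * real j" if "y \<in> Y" for y j
    using bellman_bound[OF \<alpha> that] that by simp
  have int_f: "integrable \<gamma> (\<lambda>p. ?h k (f p))"
    using bound measurable_compose[OF f_meas bellman_measurable[OF \<alpha>]]
    by (intro borel_probs_integrable[OF \<gamma>]) (auto simp: pairs_G_def)
  have int_fst: "integrable \<gamma> (\<lambda>p. ?h j (fst p))" for j
    using bound measurable_compose[OF fst_meas bellman_measurable[OF \<alpha>]]
    by (intro borel_probs_integrable[OF \<gamma>]) (auto simp: pairs_G_def)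
  have "(\<integral>p. ?h k (f p) \<partial>\<gamma>) = (\<integral>y. ?h k y \<partial>distr \<gamma> borel f)"
    by (rule integral_distr[OF f_meas bellman_measurable[OF \<alpha>], symmetric])
  also have "\<dots> = (\<integral>p. ?h k (fst p) \<partial>\<gamma>)"
    unfolding W_marginals_eq[OF \<gamma>W] by (rule integral_distr[OF fst_meas bellman_measurable[OF \<alpha>]])
  finally have shift: "(\<integral>p. ?h k (f p) \<partial>\<gamma>) = (\<integral>p. ?h k (fst p) \<partial>\<gamma>)" .
  have "(\<integral>p. ?h (Suc k) (fst p) \<partial>\<gamma>) \<le> (\<integral>p. g p + \<alpha> * ?h k (f p) \<partial>\<gamma>)"
  proof (rule integral_mono)
    fix p assume "p \<in> space \<gamma>"
    then have "p \<in> G" by (simp add: borel_probs_space[OF \<gamma>])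
    then show "?h (Suc k) (fst p) \<le> g p + \<alpha> * ?h k (f p)"
      using bellman_Suc_le[OF \<alpha>, of "fst p" "snd p" k]
      unfolding bf[OF \<open>p \<in> G\<close>, symmetric] bfst[OF \<open>p \<in> G\<close>, symmetric] by (simp del: bellman.simps)
  next
    show "integrable \<gamma> (\<lambda>p. ?h (Suc k) (fst p))" by (rule int_fst)
    show "integrable \<gamma> (\<lambda>p. g p + \<alpha> * ?h k (f p))"
      using int_f g_integrable[OF \<gamma>] by simp
  qed
  also have "\<dots> = (\<integral>p. g p \<partial>\<gamma>) + \<alpha> * (\<integral>p. ?h k (fst p) \<partial>\<gamma>)"
    using int_f g_integrable[OF \<gamma>] shift by simp
  also have "(\<integral>p. ?h k (fst p) \<partial>\<gamma>) = (\<integral>p. bellman \<alpha> k (fst p) \<partial>\<gamma>)"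
    using bfst by (intro Bochner_Integration.integral_cong) (auto simp: borel_probs_space[OF \<gamma>])
  also have "(\<integral>p. g p \<partial>\<gamma>) + \<alpha> * \<dots> \<le> (\<integral>p. g p \<partial>\<gamma>) + \<alpha> * ((\<Sum>j<k. \<alpha> ^ j) * (\<integral>p. g p \<partial>\<gamma>))"
    using \<alpha> Suc.IH by simp
  also have "\<dots> = (\<Sum>j<Suc k. \<alpha> ^ j) * (\<integral>p. g p \<partial>\<gamma>)"
    by (simp add: sum.lessThan_Suc_shift sum_distrib_left algebra_simps del: sum.lessThan_Suc)
  finally have "(\<integral>p. ?h (Suc k) (fst p) \<partial>\<gamma>) \<le> \<dots>" .
  moreover have "(\<integral>p. ?h (Suc k) (fst p) \<partial>\<gamma>) = (\<integral>p. bellman \<alpha> (Suc k) (fst p) \<partial>\<gamma>)"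
    using bfst[of _ "Suc k"] 
    by (intro Bochner_Integration.integral_cong) (auto simp: borel_probs_space[OF \<gamma>] simp del: bellman.simps)
  ultimately show ?case by linarith
qed

text \<open>Weak duality between \<open>k\<close>-step problems and the linear program.\<close>

lemma truncated_cost_bound_le_integral:
  assumes \<gamma>W: "\<gamma> \<in> W" and \<alpha>: "0 < \<alpha>" "\<alpha> \<le> 1"
    and c: "\<And>y u. y \<in> Y \<Longrightarrow> u \<in> adm_controls Y U f y \<Longrightarrow>
      c \<le> (\<Sum>t<k. \<alpha> ^ t * g (traj f y u t, u t))"
  shows "c \<le> (\<Sum>j<k. \<alpha> ^ j) * (\<integral>p. g p \<partial>\<gamma>)"
proof -
  have \<gamma>: "\<gamma> \<in> borel_probs G" using \<gamma>W by (auto simp: W_set_def)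
  interpret prob_space \<gamma> using \<gamma> by (rule borel_probs_prob_space)
  have "(\<lambda>p. indicator Y (fst p) * bellman \<alpha> k (fst p)) \<in> borel_measurable \<gamma>"
    by (rule measurable_compose[OF borel_probs_measurable[OF \<gamma> fst_cont_G] bellman_measurable[OF \<alpha>]])
  then have "(\<lambda>p. bellman \<alpha> k (fst p)) \<in> borel_measurable \<gamma>"
    by (rule measurable_cong[THEN iffD1, rotated]) (auto simp: borel_probs_space[OF \<gamma>] pairs_G_def)
  then have "integrable \<gamma> (\<lambda>p. bellman \<alpha> k (fst p))"
    using bellman_bound[OF \<alpha>] by (intro borel_probs_integrable[OF \<gamma>]) (auto simp: pairs_G_def)
  moreover have "c \<le> bellman \<alpha> k (fst p)" if "p \<in> G" for p
    using bellman_greatest[OF \<alpha> _ c] that by (auto simp: pairs_G_def)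
  ultimately have "c \<le> (\<integral>p. bellman \<alpha> k (fst p) \<partial>\<gamma>)"
    by (intro integral_ge_const) (auto simp: borel_probs_space[OF \<gamma>])
  then show ?thesis
    using bellman_integral_le[OF \<gamma>W \<alpha>, of k] by linarith
qed

lemma process_cost_bound:
  assumes "u \<in> adm_controls Y U f y"
  shows "\<bar>g (traj f y u t, u t)\<bar> \<le> M"
  using assms G_memD(4) unfolding adm_controls_def by blast

text \<open>Every admissible infinite process is also a competitor on each finite horizon.\<close>

lemma restrict_adm_controls_fin:
  assumes u: "u \<in> adm_controls Y U f y"
  shows "restrict u {..<S} \<in> adm_controls_fin Y U f S y"
    and "fin_cost f g S y (restrict u {..<S}) = (\<Sum>t<S. g (traj f y u t, u t))"
proof -
  have traj_eq: "traj f y (restrict u {..<S}) t = traj f y u t" if "t < S" for t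
    using that by (intro traj_cong) auto
  then show "restrict u {..<S} \<in> adm_controls_fin Y U f S y"
    using u by (auto simp: adm_controls_fin_def adm_controls_def)
  show "fin_cost f g S y (restrict u {..<S}) = (\<Sum>t<S. g (traj f y u t, u t))"
    unfolding fin_cost_def using traj_eq by (intro sum.cong) auto
qed

lemma val_disc_optimal:
  assumes opt: "disc_optimal Y U f g \<alpha> y0 u" and "\<alpha> < 1"
  shows "val_disc Y U f g \<alpha> y0 = (1 - \<alpha>) * disc_cost f g \<alpha> y0 u"
    and "z \<in> Y \<Longrightarrow> val_disc Y U f g \<alpha> y0 \<le> val_disc Y U f g \<alpha> z"
proof -
  show eq: "val_disc Y U f g \<alpha> y0 = (1 - \<alpha>) * disc_cost f g \<alpha> y0 u"
    unfolding val_disc_def using opt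
    by (subst INF_eq_minimum[of u]) (auto simp: disc_optimal_def)
  assume "z \<in> Y"
  then have "disc_cost f g \<alpha> y0 u \<le> (INF v\<in>adm_controls Y U f z. disc_cost f g \<alpha> z v)"
    using opt viable by (intro cINF_greatest) (auto simp: disc_optimal_def)
  then show "val_disc Y U f g \<alpha> y0 \<le> val_disc Y U f g \<alpha> z"
    unfolding eq unfolding val_disc_def using \<open>\<alpha> < 1\<close> by (intro mult_left_mono) auto
qed

lemma val_fin_optimal:
  assumes opt: "fin_optimal Y U f g S y0 u"
  shows "val_fin Y U f g S y0 = 1 / real S * fin_cost f g S y0 u"
    and "z \<in> Y \<Longrightarrow> val_fin Y U f g S y0 \<le> val_fin Y U f g S z"
proof -
  show eq: "val_fin Y U f g S y0 = 1 / real S * fin_cost f g S y0 u"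
    unfolding val_fin_def using opt
    by (subst INF_eq_minimum[of u]) (auto simp: fin_optimal_def)
  assume z: "z \<in> Y"
  then have "adm_controls_fin Y U f S z \<noteq> {}"
    using viable restrict_adm_controls_fin(1) by blast
  then have "fin_cost f g S y0 u \<le> (INF v\<in>adm_controls_fin Y U f S z. fin_cost f g S z v)"
    using opt z by (intro cINF_greatest) (auto simp: fin_optimal_def)
  then show "val_fin Y U f g S y0 \<le> val_fin Y U f g S z"
    unfolding eq unfolding val_fin_def by (intro mult_left_mono) auto
qed

text \<open>Cutting the discounted series after \<open>k\<close> terms costs at most \<open>\<alpha>^k M / (1 - \<alpha>)\<close>; the bound for
  truncated costs then gives the claim as \<open>k \<longlongrightarrow> \<infinity>\<close>.\<close>

lemma disc_optimal_le_integral: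
  assumes \<gamma>: "\<gamma> \<in> W" and \<alpha>: "0 < \<alpha>" "\<alpha> < 1" and opt: "disc_optimal Y U f g \<alpha> y0 u"
  shows "(1 - \<alpha>) * disc_cost f g \<alpha> y0 u \<le> (\<integral>p. g p \<partial>\<gamma>)"
proof -
  let ?c = "disc_cost f g \<alpha> y0 u"
  have k: "?c - \<alpha> ^ k * (M / (1 - \<alpha>)) \<le> (\<Sum>j<k. \<alpha> ^ j) * (\<integral>p. g p \<partial>\<gamma>)" for k
  proof (rule truncated_cost_bound_le_integral[OF \<gamma>])
    fix z v assume z: "z \<in> Y" and v: "v \<in> adm_controls Y U f z"
    let ?a = "\<lambda>t. g (traj f z v t, v t)"
    have a: "\<bar>?a t\<bar> \<le> M" for t using v by (rule process_cost_bound)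
    have sum: "summable (\<lambda>t. \<alpha> ^ t * ?a t)" using \<alpha> a by (rule summable_discounted)
    have geom: "(\<lambda>t. \<alpha> ^ k * M * \<alpha> ^ t) sums (\<alpha> ^ k * M * (1 / (1 - \<alpha>)))"
      using \<alpha> by (intro sums_mult geometric_sums) auto
    have "?c \<le> (\<Sum>t. \<alpha> ^ t * ?a t)"
      using opt z v unfolding disc_optimal_def disc_cost_def by blast
    also have "\<dots> = (\<Sum>t. \<alpha> ^ (t + k) * ?a (t + k)) + (\<Sum>t<k. \<alpha> ^ t * ?a t)"
      using sum by (rule suminf_split_initial_segment)
    also have "(\<Sum>t. \<alpha> ^ (t + k) * ?a (t + k)) \<le> (\<Sum>t. \<alpha> ^ k * M * \<alpha> ^ t)"
    proof (rule suminf_le)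
      show "\<alpha> ^ (t + k) * ?a (t + k) \<le> \<alpha> ^ k * M * \<alpha> ^ t" for t
        using mult_left_mono[of "?a (t + k)" M "\<alpha> ^ (t + k)"] a[of "t + k"] \<alpha>
        by (simp add: power_add mult_ac abs_le_iff)
      show "summable (\<lambda>t. \<alpha> ^ (t + k) * ?a (t + k))"
        using sum by (subst summable_iff_shift)
      show "summable (\<lambda>t. \<alpha> ^ k * M * \<alpha> ^ t)"
        using geom by (rule sums_summable)
    qed
    finally show "?c - \<alpha> ^ k * (M / (1 - \<alpha>)) \<le> (\<Sum>t<k. \<alpha> ^ t * ?a t)"
      using sums_unique[OF geom] by simp
  qed (use \<alpha> in auto)
  have "?c - 0 * (M / (1 - \<alpha>)) \<le> 1 / (1 - \<alpha>) * (\<integral>p. g p \<partial>\<gamma>)"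
  proof (rule LIMSEQ_le)
    show "(\<lambda>k. ?c - \<alpha> ^ k * (M / (1 - \<alpha>))) \<longlonglongrightarrow> ?c - 0 * (M / (1 - \<alpha>))"
      using \<alpha> by (intro tendsto_intros LIMSEQ_power_zero) auto
    have "(\<lambda>k. \<Sum>j<k. \<alpha> ^ j) \<longlonglongrightarrow> 1 / (1 - \<alpha>)"
      using geometric_sums[of \<alpha>] \<alpha> by (simp add: sums_def)
    then show "(\<lambda>k. (\<Sum>j<k. \<alpha> ^ j) * (\<integral>p. g p \<partial>\<gamma>)) \<longlonglongrightarrow> 1 / (1 - \<alpha>) * (\<integral>p. g p \<partial>\<gamma>)"
      by (rule tendsto_mult_right)
  qed (use k in blast)
  then show ?thesis
    using \<alpha> by (simp add: pos_le_divide_eq mult.commute)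
qed

lemma fin_optimal_le_integral:
  assumes \<gamma>: "\<gamma> \<in> W" and S: "0 < S" and opt: "fin_optimal Y U f g S y0 u"
  shows "1 / real S * fin_cost f g S y0 u \<le> (\<integral>p. g p \<partial>\<gamma>)"
proof -
  have "fin_cost f g S y0 u \<le> (\<Sum>j<S. 1 ^ j) * (\<integral>p. g p \<partial>\<gamma>)"
  proof (rule truncated_cost_bound_le_integral[OF \<gamma>])
    fix z v assume z: "z \<in> Y" and v: "v \<in> adm_controls Y U f z"
    then have "fin_cost f g S y0 u \<le> fin_cost f g S z (restrict v {..<S})"
      using opt restrict_adm_controls_fin(1)[OF v, of S] unfolding fin_optimal_def by blast
    then show "fin_cost f g S y0 u \<le> (\<Sum>t<S. 1 ^ t * g (traj f z v t, v t))"
      using restrict_adm_controls_fin(2)[OF v, of S] by simp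
  qed auto
  then show ?thesis
    using S by (simp add: pos_divide_le_eq mult.commute)
qed

section \<open>Occupational measures of optimal processes\<close>

text \<open>The argument common to both problems. Here \<open>P n\<close> is the law of the random time and \<open>x n\<close> the
  process. Every subsequence of occupational measures has a further subsequence that converges to
  some \<open>\<gamma> \<in> W\<close>, so the values converge to \<open>\<integral>g d\<gamma>\<close> along it. This integral is at least
  \<open>g\<^sup>*\<close> since \<open>\<gamma>\<close> is feasible, and at most \<open>g\<^sup>*\<close> since each value bounds all feasible integrals from
  below. In particular \<open>W\<close> is not empty, without which \<open>g\<^sup>*\<close> would be an infimum over the empty set.\<close>

lemma occupational_values_tendsto_g_star:
  fixes P :: "nat \<Rightarrow> 'i pmf" and x :: "nat \<Rightarrow> 'i \<Rightarrow> 'a \<times> 'u"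
  assumes K: "compact K" "K \<subseteq> G"
    and xK: "\<And>n i. i \<in> set_pmf (P n) \<Longrightarrow> x n i \<in> K"
    and inv: "\<And>\<phi>. \<phi> \<in> cont_compactification Y \<Longrightarrow>
      (\<lambda>n. \<integral>i. \<phi> (f (x n i)) - \<phi> (fst (x n i)) \<partial>measure_pmf (P n)) \<longlonglongrightarrow> 0"
    and val: "\<And>n. a n = (\<integral>i. g (x n i) \<partial>measure_pmf (P n))"
    and le: "\<And>n \<gamma>. \<gamma> \<in> W \<Longrightarrow> a n \<le> (\<integral>p. g p \<partial>\<gamma>)"
  shows "a \<longlonglongrightarrow> g_star Y U f g"
proof -
  have subseq: "\<exists>r \<gamma>. strict_mono r \<and> \<gamma> \<in> W \<and> (\<lambda>n. a (s (r n))) \<longlonglongrightarrow> (\<integral>p. g p \<partial>\<gamma>)"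
    if s: "strict_mono s" for s :: "nat \<Rightarrow> nat"
  proof -
    show ?thesis
    proof (rule pmf_laws_on_compact_convergent_subseq[OF K, of "\<lambda>n. P (s n)" "\<lambda>n. x (s n)"])
      show "x (s n) i \<in> K" if "i \<in> set_pmf (P (s n))" for n i
        using that by (rule xK)
      fix r :: "nat \<Rightarrow> nat" and \<gamma>
      assume r: "strict_mono r" and \<gamma>: "\<gamma> \<in> borel_probs G"
        and conv: "\<And>\<phi>. continuous_on G \<phi> \<Longrightarrow>
          (\<lambda>n. \<integral>i. (\<phi> (x (s (r n)) i) :: real) \<partial>measure_pmf (P (s (r n)))) \<longlonglongrightarrow> (\<integral>p. \<phi> p \<partial>\<gamma>)"
      have "(\<integral>(y, u). \<phi> (f (y, u)) - \<phi> y \<partial>\<gamma>) = 0" if \<phi>: "\<phi> \<in> cont_compactification Y" for \<phi>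
      proof -
        have "continuous_on Y \<phi>" using \<phi> by (auto simp: cont_compactification_def)
        then have "continuous_on G (\<lambda>p. \<phi> (f p) - \<phi> (fst p))"
          by (intro continuous_intros continuous_on_compose2[OF _ f_cont_G]
              continuous_on_compose2[OF _ fst_cont_G]) (auto simp: pairs_G_def)
        from conv[OF this] LIMSEQ_subseq_LIMSEQ[OF inv[OF \<phi>] strict_mono_o[OF s r]]
        have "(\<integral>p. \<phi> (f p) - \<phi> (fst p) \<partial>\<gamma>) = 0"
          by (auto simp: comp_def intro: LIMSEQ_unique)
        then show ?thesis by (simp add: case_prod_beta')
      qed
      then have "\<gamma> \<in> W" using \<gamma> by (simp add: W_set_def)
      with r conv[OF g_cont_G] show ?thesis unfolding val by blast
    qed
  qed
  have bdd: "bdd_below ((\<lambda>\<gamma>. \<integral>p. g p \<partial>\<gamma>) ` W)"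
    using le[where n=0] by (intro bdd_belowI2)
  have "W \<noteq> {}" using subseq[OF strict_mono_id] by auto
  then have a_le: "a n \<le> g_star Y U f g" for n
    unfolding g_star_def using le by (intro cINF_greatest)
  show ?thesis
  proof (rule tendstoI, rule ccontr)
    fix e :: real assume e: "e > 0" and "\<not> (\<forall>\<^sub>F n in sequentially. dist (a n) (g_star Y U f g) < e)"
    then have "infinite {n. \<not> dist (a n) (g_star Y U f g) < e}"
      by (simp add: cofinite_eq_sequentially[symmetric] eventually_cofinite)
    then obtain s :: "nat \<Rightarrow> nat" where s: "strict_mono s" "\<And>n. \<not> dist (a (s n)) (g_star Y U f g) < e"
      using infinite_enumerate by blast
    then obtain r \<gamma> where r: "\<gamma> \<in> W" "(\<lambda>n. a (s (r n))) \<longlonglongrightarrow> (\<integral>p. g p \<partial>\<gamma>)"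
      using subseq by blast
    have "g_star Y U f g \<le> (\<integral>p. g p \<partial>\<gamma>)"
      unfolding g_star_def using bdd r(1) by (rule cINF_lower)
    moreover have "(\<integral>p. g p \<partial>\<gamma>) \<le> g_star Y U f g"
      using a_le by (intro LIMSEQ_le_const2[OF r(2)]) auto
    ultimately have "(\<lambda>n. a (s (r n))) \<longlonglongrightarrow> g_star Y U f g"
      using r(2) by (metis antisym)
    from tendstoD[OF this e] s(2) show False by simp
  qed
qed

text \<open>Successor states are bounded through \<open>\<phi> \<circ> f\<close> on \<open>K\<close>: a finite process ends in a state that is not
  the first component of any of its pairs.\<close>

lemma test_function_bounded_on_compact:
  assumes K: "compact K" "K \<subseteq> G" and \<phi>: "\<phi> \<in> cont_compactification Y"
  obtains B where "\<And>p. p \<in> K \<Longrightarrow> \<bar>\<phi> (f p)\<bar> \<le> B" "\<And>p. p \<in> K \<Longrightarrow> \<bar>\<phi> (fst p)\<bar> \<le> B"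
proof -
  have cont: "continuous_on Y \<phi>" using \<phi> by (auto simp: cont_compactification_def)
  have "continuous_on G (\<lambda>p. \<phi> (f p))" "continuous_on G (\<lambda>p. \<phi> (fst p))"
    by (rule continuous_on_compose2[OF cont f_cont_G] continuous_on_compose2[OF cont fst_cont_G];
        auto simp: pairs_G_def)+
  then have "bounded ((\<lambda>p. \<phi> (f p)) ` K)" "bounded ((\<lambda>p. \<phi> (fst p)) ` K)"
    using K by (auto intro!: compact_imp_bounded compact_continuous_image intro: continuous_on_subset)
  then obtain B1 B2 where "\<And>p. p \<in> K \<Longrightarrow> \<bar>\<phi> (f p)\<bar> \<le> B1" "\<And>p. p \<in> K \<Longrightarrow> \<bar>\<phi> (fst p)\<bar> \<le> B2"
    unfolding bounded_iff by auto
  then show thesis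
    by (intro that[of "max B1 B2"]) (force simp: le_max_iff_disj)+
qed

lemma disc_values_tendsto_g_star:
  assumes K: "compact K" "K \<subseteq> G"
    and \<alpha>: "\<And>n. 0 < \<alpha> n" "\<And>n. \<alpha> n < 1" "\<alpha> \<longlonglongrightarrow> 1"
    and opt: "\<And>n. disc_optimal Y U f g (\<alpha> n) (y n) (u n)"
    and inK: "\<And>n t. (traj f (y n) (u n) t, u n t) \<in> K"
  shows "(\<lambda>n. (1 - \<alpha> n) * disc_cost f g (\<alpha> n) (y n) (u n)) \<longlonglongrightarrow> g_star Y U f g"
proof (rule occupational_values_tendsto_g_star[OF K,
      where P = "\<lambda>n. geometric_pmf (1 - \<alpha> n)" and x = "\<lambda>n t. (traj f (y n) (u n) t, u n t)"])
  show "(traj f (y n) (u n) t, u n t) \<in> K" for n t by (rule inK)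
  show "(1 - \<alpha> n) * disc_cost f g (\<alpha> n) (y n) (u n) =
      (\<integral>t. g (traj f (y n) (u n) t, u n t) \<partial>measure_pmf (geometric_pmf (1 - \<alpha> n)))" for n
    unfolding disc_cost_def using opt[of n] process_cost_bound
    by (intro expectation_geometric_pmf_discounted[symmetric, OF \<alpha>(1,2)]) (auto simp: disc_optimal_def)
  show "(1 - \<alpha> n) * disc_cost f g (\<alpha> n) (y n) (u n) \<le> (\<integral>p. g p \<partial>\<gamma>)" if "\<gamma> \<in> W" for n \<gamma>
    using disc_optimal_le_integral[OF that \<alpha>(1,2) opt] .
  fix \<phi> assume "\<phi> \<in> cont_compactification Y"
  then obtain B where B: "\<And>p. p \<in> K \<Longrightarrow> \<bar>\<phi> (f p)\<bar> \<le> B" "\<And>p. p \<in> K \<Longrightarrow> \<bar>\<phi> (fst p)\<bar> \<le> B"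
    using test_function_bounded_on_compact[OF K] by metis
  let ?E = "\<lambda>n. \<integral>t. \<phi> (f (traj f (y n) (u n) t, u n t)) - \<phi> (fst (traj f (y n) (u n) t, u n t))
      \<partial>measure_pmf (geometric_pmf (1 - \<alpha> n))"
  have bound: "\<bar>?E n\<bar> \<le> 2 * B * (1 - \<alpha> n)" for n
    using expectation_geometric_pmf_increment_bound[OF \<alpha>(1,2), of "\<lambda>t. \<phi> (traj f (y n) (u n) t)" B n]
      B(2)[OF inK, of n] by simp
  have "(\<lambda>n. 2 * B * (1 - \<alpha> n)) \<longlonglongrightarrow> 2 * B * (1 - 1)"
    using \<alpha>(3) by (intro tendsto_intros)
  then have "(\<lambda>n. 2 * B * (1 - \<alpha> n)) \<longlonglongrightarrow> 0" by simp
  then show "?E \<longlonglongrightarrow> 0"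
    by (rule Lim_null_comparison[rotated]) (use bound in \<open>simp only: real_norm_def eventually_True\<close>)
qed

lemma fin_values_tendsto_g_star:
  assumes K: "compact K" "K \<subseteq> G"
    and opt: "\<And>n. fin_optimal Y U f g (Suc n) (y n) (u n)"
    and inK: "\<And>n t. t < Suc n \<Longrightarrow> (traj f (y n) (u n) t, u n t) \<in> K"
  shows "(\<lambda>n. 1 / real (Suc n) * fin_cost f g (Suc n) (y n) (u n)) \<longlonglongrightarrow> g_star Y U f g"
proof (rule occupational_values_tendsto_g_star[OF K,
      where P = "\<lambda>n. pmf_of_set {..<Suc n}" and x = "\<lambda>n t. (traj f (y n) (u n) t, u n t)"])
  have supp: "set_pmf (pmf_of_set {..<Suc n}) = {..<Suc n}" for n
    by (rule set_pmf_of_set) auto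
  show "(traj f (y n) (u n) t, u n t) \<in> K" if "t \<in> set_pmf (pmf_of_set {..<Suc n})" for n t
    using that inK unfolding supp by simp
  show "1 / real (Suc n) * fin_cost f g (Suc n) (y n) (u n) =
      (\<integral>t. g (traj f (y n) (u n) t, u n t) \<partial>measure_pmf (pmf_of_set {..<Suc n}))" for n
    unfolding fin_cost_def by (subst integral_pmf_of_set) (auto simp del: sum.lessThan_Suc)
  show "1 / real (Suc n) * fin_cost f g (Suc n) (y n) (u n) \<le> (\<integral>p. g p \<partial>\<gamma>)" if "\<gamma> \<in> W" for n \<gamma>
    using fin_optimal_le_integral[OF that _ opt] by simp
  fix \<phi> assume "\<phi> \<in> cont_compactification Y"
  then obtain B where B: "\<And>p. p \<in> K \<Longrightarrow> \<bar>\<phi> (f p)\<bar> \<le> B" "\<And>p. p \<in> K \<Longrightarrow> \<bar>\<phi> (fst p)\<bar> \<le> B"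
    using test_function_bounded_on_compact[OF K] by metis
  let ?E = "\<lambda>n. \<integral>t. \<phi> (f (traj f (y n) (u n) t, u n t)) - \<phi> (fst (traj f (y n) (u n) t, u n t))
      \<partial>measure_pmf (pmf_of_set {..<Suc n})"
  have bound: "\<bar>?E n\<bar> \<le> 2 * B * (1 / real (Suc n))" for n
  proof -
    have "?E n = (\<phi> (traj f (y n) (u n) (Suc n)) - \<phi> (traj f (y n) (u n) 0)) / real (Suc n)"
      using expectation_uniform_increment[of "Suc n" "\<lambda>t. \<phi> (traj f (y n) (u n) t)"] by simp
    moreover have "\<bar>\<phi> (traj f (y n) (u n) (Suc n)) - \<phi> (traj f (y n) (u n) 0)\<bar> \<le> 2 * B"
      using B(1)[OF inK[of n n]] B(2)[OF inK[of 0 n]] by simp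
    ultimately show ?thesis
      by (simp add: divide_right_mono)
  qed
  have "(\<lambda>n. 2 * B * (1 / real (Suc n))) \<longlonglongrightarrow> 2 * B * 0"
    by (intro tendsto_mult_left LIMSEQ_Suc[OF lim_1_over_n])
  then have "(\<lambda>n. 2 * B * (1 / real (Suc n))) \<longlonglongrightarrow> 0" by simp
  then show "?E \<longlonglongrightarrow> 0"
    by (rule Lim_null_comparison[rotated]) (use bound in \<open>simp only: real_norm_def eventually_True\<close>)
qed

end

section \<open>The limit theorem\<close>

theorem theorem5p4:
  fixes Y :: "(real ^ 'm) set"
    and U0 :: "'u::metric_space set"
    and U :: "real ^ 'm \<Rightarrow> 'u set"
    and f :: "(real ^ 'm) \<times> 'u \<Rightarrow> real ^ 'm"
    and g :: "(real ^ 'm) \<times> 'u \<Rightarrow> real"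
    and D :: "((real ^ 'm) \<times> 'u) set"
  assumes Y: "Y \<noteq> {}" "closed Y" "\<not> bounded Y"
    and U0: "compact U0"
    and U: "\<And>y. y \<in> Y \<Longrightarrow> U y \<subseteq> U0" "\<And>y. y \<in> Y \<Longrightarrow> compact (U y)" "usc_on Y U"
    and f_cont: "continuous_on (UNIV \<times> U0) f"
    and f_growth: "\<And>K::real. \<forall>\<^sub>F y in at_infinity. \<forall>u\<in>U0. K \<le> norm (f (y, u))"
    and viable: "\<And>y0. y0 \<in> Y \<Longrightarrow> adm_controls Y U f y0 \<noteq> {}"
    and g_cont: "continuous_on (UNIV \<times> U0) g"
    and g_bdd: "bounded (g ` (UNIV \<times> U0))"
    and opt_disc_ex: "\<And>\<alpha>. \<alpha> \<in> {0<..<1} \<Longrightarrow> \<exists>y0 u. disc_optimal Y U f g \<alpha> y0 u"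
    and opt_fin_ex: "\<And>S. S \<ge> 1 \<Longrightarrow> \<exists>y0 u. fin_optimal Y U f g S y0 u"
    and D: "D \<subseteq> pairs_G Y U f" "bounded D"
    and opt_disc_D: "\<And>\<alpha> y0 u t. \<alpha> \<in> {0<..<1} \<Longrightarrow> disc_optimal Y U f g \<alpha> y0 u \<Longrightarrow>
                       (traj f y0 u t, u t) \<in> D"
    and opt_fin_D: "\<And>S y0 u t. S \<ge> 1 \<Longrightarrow> fin_optimal Y U f g S y0 u \<Longrightarrow> t < S \<Longrightarrow>
                       (traj f y0 u t, u t) \<in> D"
  shows "(\<forall>\<alpha>\<in>{0<..<1}. \<exists>y\<in>Y. \<forall>z\<in>Y. val_disc Y U f g \<alpha> y \<le> val_disc Y U f g \<alpha> z)
       \<and> (\<forall>S\<ge>1. \<exists>y\<in>Y. \<forall>z\<in>Y. val_fin Y U f g S y \<le> val_fin Y U f g S z)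
       \<and> ((\<lambda>\<alpha>. INF y\<in>Y. val_disc Y U f g \<alpha> y) \<longlongrightarrow> g_star Y U f g) (at_left 1)
       \<and> (\<lambda>S. INF y\<in>Y. val_fin Y U f g S y) \<longlonglongrightarrow> g_star Y U f g"
proof -
  obtain M where M: "\<And>p. p \<in> UNIV \<times> U0 \<Longrightarrow> \<bar>g p\<bar> \<le> M"
    using g_bdd unfolding bounded_iff by auto
  interpret control_system Y U0 U f g M
    by unfold_locales (use Y U0 U f_cont g_cont M viable in auto)
  obtain b where b: "\<And>p. p \<in> D \<Longrightarrow> norm (fst p) \<le> b"
    using bounded_fst[OF D(2)] unfolding bounded_iff by auto
  \<comment> \<open>Boundedness of \<open>D\<close> controls the states; compactness of the controls comes from \<open>U0\<close>.\<close>
  define K where "K = closure D"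
  have "D \<subseteq> cball 0 b \<times> U0"
  proof
    fix p assume "p \<in> D"
    then have "snd p \<in> U0" using D(1) G_subset by (auto simp: mem_Times_iff)
    then show "p \<in> cball 0 b \<times> U0" using b[OF \<open>p \<in> D\<close>] by (simp add: mem_Times_iff)
  qed
  then have "K \<subseteq> cball 0 b \<times> U0"
    unfolding K_def using compact_imp_closed[OF U0] by (intro closure_minimal closed_Times closed_cball)
  then have "K = (cball 0 b \<times> U0) \<inter> K"
    by blast
  moreover have "compact ((cball 0 b \<times> U0) \<inter> K)"
    unfolding K_def by (intro compact_Int_closed compact_Times compact_cball U0 closed_closure)
  ultimately have K: "compact K"
    by (rule ssubst)
  have KG: "K \<subseteq> G"
    unfolding K_def using D(1) closed_G by (rule closure_minimal)
  have DK: "p \<in> K" if "p \<in> D" for p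
    using that closure_subset unfolding K_def by blast
  obtain yd ud where d: "\<And>\<alpha>. \<alpha> \<in> {0<..<1} \<Longrightarrow> disc_optimal Y U f g \<alpha> (yd \<alpha>) (ud \<alpha>)"
    using opt_disc_ex by metis
  obtain yf uf where n: "\<And>S. S \<ge> 1 \<Longrightarrow> fin_optimal Y U f g S (yf S) (uf S)"
    using opt_fin_ex by metis
  have yd: "yd \<alpha> \<in> Y" "\<forall>z\<in>Y. val_disc Y U f g \<alpha> (yd \<alpha>) \<le> val_disc Y U f g \<alpha> z"
    if "\<alpha> \<in> {0<..<1}" for \<alpha>
    using d[OF that] val_disc_optimal(2)[OF d[OF that]] that by (auto simp: disc_optimal_def)
  have yf: "yf S \<in> Y" "\<forall>z\<in>Y. val_fin Y U f g S (yf S) \<le> val_fin Y U f g S z"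
    if "S \<ge> 1" for S
    using n[OF that] val_fin_optimal(2)[OF n[OF that]] by (auto simp: fin_optimal_def)
  have min_disc: "(INF y\<in>Y. val_disc Y U f g \<alpha> y) = (1 - \<alpha>) * disc_cost f g \<alpha> (yd \<alpha>) (ud \<alpha>)"
    if "\<alpha> \<in> {0<..<1}" for \<alpha>
    using INF_eq_minimum[of "yd \<alpha>" Y "val_disc Y U f g \<alpha>"] yd[OF that]
      val_disc_optimal(1)[OF d[OF that]] that by simp
  have min_fin: "(INF y\<in>Y. val_fin Y U f g S y) = 1 / real S * fin_cost f g S (yf S) (uf S)"
    if "S \<ge> 1" for S
    using INF_eq_minimum[of "yf S" Y "val_fin Y U f g S"] yf[OF that]
      val_fin_optimal(1)[OF n[OF that]] by simp
  have "((\<lambda>\<alpha>. INF y\<in>Y. val_disc Y U f g \<alpha> y) \<longlongrightarrow> g_star Y U f g) (at_left 1)"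
  proof (rule tendsto_at_left_sequentially[of 0])
    fix \<alpha> :: "nat \<Rightarrow> real"
    assume \<alpha>: "\<And>n. \<alpha> n < 1" "\<And>n. 0 < \<alpha> n" "\<alpha> \<longlonglongrightarrow> 1"
    then have "\<alpha> n \<in> {0<..<1}" for n by simp
    note mem = this
    have "(\<lambda>n. (1 - \<alpha> n) * disc_cost f g (\<alpha> n) (yd (\<alpha> n)) (ud (\<alpha> n))) \<longlonglongrightarrow> g_star Y U f g"
      by (rule disc_values_tendsto_g_star[OF K KG \<alpha>(2,1,3) d[OF mem] DK[OF opt_disc_D[OF mem d[OF mem]]]])
    then show "(\<lambda>n. INF y\<in>Y. val_disc Y U f g (\<alpha> n) y) \<longlonglongrightarrow> g_star Y U f g"
      by (simp add: min_disc[OF mem])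
  qed simp
  moreover have "(\<lambda>S. INF y\<in>Y. val_fin Y U f g S y) \<longlonglongrightarrow> g_star Y U f g"
  proof (rule LIMSEQ_imp_Suc)
    have S: "1 \<le> Suc k" for k by simp
    have "(\<lambda>k. 1 / real (Suc k) * fin_cost f g (Suc k) (yf (Suc k)) (uf (Suc k))) \<longlonglongrightarrow> g_star Y U f g"
      by (rule fin_values_tendsto_g_star[OF K KG n[OF S] DK[OF opt_fin_D[OF S n[OF S]]]])
    then show "(\<lambda>k. INF y\<in>Y. val_fin Y U f g (Suc k) y) \<longlonglongrightarrow> g_star Y U f g"
      by (simp only: min_fin[OF S])
  qed
  ultimately show ?thesis
    using yd yf by blast
qed

end
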